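(* For all $m\ge 3$, $$A(t_m)=\frac{m}{22}\left(9t_m-t_{m-1}-5t_{m-2}\right)+\frac{1}{44}\left(-81t_m+26t_{m-1}+13t_{m-2}\right)+m+\frac14.$$
   Context: The Tribonacci sequence $\mathbb{T}$ is the fixed point beginning with $a$ of the substitution $\sigma(a)=ab,\ \sigma(b)=ac,\ \sigma(c)=a$; positions are numbered from $1$ and $\mathbb{T}[1,n]$ is the prefix of length $n$. For a nonempty factor $\omega$ of $\mathbb{T}$, $\omega_p$ denotes its $p$-th occurrence. The word $\omega_p\omega_{p+1}$ is a (repeated) square if $\omega_{p+1}$ begins immediately after $\omega_p$ ends. $A(n)$ is the number of pairs $(\omega,p)$ such that $\omega_p\omega_{p+1}$ is a square contained in $\mathbb{T}[1,n]$, i.e. ending at a position $\le n$. The Tribonacci numbers are $t_m=|\sigma^m(a)|$ for $m\ge 0$ ($t_0=1,t_1=2,t_2=4,t_3=7$, $t_m=t_{m-1}+t_{m-2}+t_{m-3}$). *)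

theory Defs
  imports Complex_Main "HOL-Library.Stream"
begin

datatype letter = La | Lb | Lc

fun sigma :: "letter \<Rightarrow> letter list" where
  "sigma La = [La, Lb]"
| "sigma Lb = [La, Lc]"
| "sigma Lc = [La]"

definition subst :: "letter list \<Rightarrow> letter list" where
  "subst w = concat (map sigma w)"

definition subst_inf :: "letter stream \<Rightarrow> letter stream" where
  "subst_inf x = flat (smap sigma x)"

text \<open>The fixed point of the substitution that begins with \<open>La\<close>; existence and uniqueness are
  proved in \<open>tribonacci_ex1\<close> below.\<close>

definition tribonacci :: "letter stream" where
  "tribonacci = (THE x. subst_inf x = x \<and> shd x = La)"

definition trib_num :: "nat \<Rightarrow> nat" where
  "trib_num m = length ((subst ^^ m) [La])"

text \<open>Positions in the word are numbered from 1, whereas streams are indexed from 0.\<close>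

definition occurs_at :: "letter list \<Rightarrow> nat \<Rightarrow> bool" where
  "occurs_at w i \<longleftrightarrow> 1 \<le> i \<and> stake (length w) (sdrop (i - 1) tribonacci) = w"

text \<open>The \<open>p\<close>-th occurrence of \<open>w\<close> begins at position \<open>i\<close>; occurrences may overlap and are
  counted from 1, in the order of their starting positions.\<close>

definition nth_occurrence :: "letter list \<Rightarrow> nat \<Rightarrow> nat \<Rightarrow> bool" where
  "nth_occurrence w p i \<longleftrightarrow> occurs_at w i \<and> card {j. j \<le> i \<and> occurs_at w j} = p"

definition square_at :: "letter list \<Rightarrow> nat \<Rightarrow> nat \<Rightarrow> bool" where
  "square_at w p i \<longleftrightarrow> nth_occurrence w p i \<and> nth_occurrence w (p + 1) (i + length w)"

text \<open>The square beginning at position \<open>i\<close> ends at position \<open>i + 2 * length w - 1\<close>.\<close>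

definition squares_in_prefix :: "nat \<Rightarrow> (letter list \<times> nat) set" where
  "squares_in_prefix n =
     {(w, p). w \<noteq> [] \<and> (\<exists>i. square_at w p i \<and> i + 2 * length w - 1 \<le> n)}"

definition num_squares :: "nat \<Rightarrow> nat" where
  "num_squares n = card (squares_in_prefix n)"


lemma sigma_nonempty [simp]: "sigma l \<noteq> []"
  by (cases l) auto

lemma subst_append: "subst (u @ v) = subst u @ subst v"
  by (simp add: subst_def)

lemma length_subst_ge: "length w \<le> length (subst w)"
proof (induction w)
  case (Cons l w)
  have "1 \<le> length (sigma l)" by (cases l) auto
  with Cons show ?case by (simp add: subst_def)
qed (simp add: subst_def)

lemma subst_inf_shift: "subst_inf (w @- s) = subst w @- subst_inf s"
proof (induction w)
  case (Cons l w)
  have "subst_inf ((l # w) @- s) = sigma l @- subst_inf (w @- s)"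
    unfolding subst_inf_def using flat_unfold[of "smap sigma ((l # w) @- s)"] by simp
  with Cons show ?case by (simp add: subst_def)
qed (simp add: subst_def)

lemma iter_subst_Suc: "\<exists>v. v \<noteq> [] \<and> (subst ^^ Suc m) [La] = (subst ^^ m) [La] @ v"
proof (induction m)
  case 0
  show ?case by (simp add: subst_def)
next
  case (Suc m)
  then obtain v where v: "v \<noteq> []" "(subst ^^ Suc m) [La] = (subst ^^ m) [La] @ v" by blast
  have "subst v \<noteq> []" using length_subst_ge[of v] v(1) by auto
  moreover have "(subst ^^ Suc (Suc m)) [La] = (subst ^^ Suc m) [La] @ subst v"
    using v(2) by (simp add: subst_append)
  ultimately show ?case by blast
qed

lemma iter_subst_mono: "\<exists>v. (subst ^^ (m + k)) [La] = (subst ^^ m) [La] @ v"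
proof (induction k)
  case (Suc k)
  then show ?case using iter_subst_Suc[of "m + k"] by auto
qed simp

lemma trib_num_gt: "m < trib_num m"
proof (induction m)
  case (Suc m)
  obtain v where "v \<noteq> []" "(subst ^^ Suc m) [La] = (subst ^^ m) [La] @ v"
    using iter_subst_Suc by blast
  then have "trib_num m < trib_num (Suc m)" by (simp add: trib_num_def)
  with Suc show ?case by simp
qed (simp add: trib_num_def)

lemma stream_eqI:
  assumes "\<And>n. x !! n = y !! n"
  shows "x = y"
  using assms smap_alt[of id x y] by (simp add: stream.map_id)

lemma fixed_point_prefix:
  assumes "subst_inf x = x" and "shd x = La"
  shows "\<exists>s. x = (subst ^^ m) [La] @- s"
proof (induction m)
  case 0
  have "x = [La] @- stl x" using assms(2) by (cases x) auto
  then have "x = (subst ^^ 0) [La] @- stl x" by (simp only: funpow_0)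
  then show ?case by (rule exI)
next
  case (Suc m)
  then obtain s where "x = (subst ^^ m) [La] @- s" by blast
  then have "subst_inf x = (subst ^^ Suc m) [La] @- subst_inf s"
    by (simp add: subst_inf_shift)
  then have "x = (subst ^^ Suc m) [La] @- subst_inf s"
    by (simp only: assms(1))
  then show ?case by blast
qed

lemma fixed_point_snth:
  assumes "\<And>m. \<exists>s. x = (subst ^^ m) [La] @- s"
  shows "x !! n = (subst ^^ n) [La] ! n"
proof -
  obtain s where "x = (subst ^^ n) [La] @- s" using assms by blast
  then show ?thesis using trib_num_gt[of n] by (simp add: trib_num_def shift_snth_less)
qed

lemma tribonacci_ex1: "\<exists>!x. subst_inf x = x \<and> shd x = La"
proof (rule ex_ex1I)
  define x where "x = smap (\<lambda>n. (subst ^^ n) [La] ! n) nats"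
  have nth: "(subst ^^ m) [La] ! n = x !! n" if "n < trib_num m" for m n
  proof (cases "n \<le> m")
    case True
    then obtain k where k: "m = n + k" using le_Suc_ex by blast
    obtain v where "(subst ^^ m) [La] = (subst ^^ n) [La] @ v"
      using iter_subst_mono k by blast
    then show ?thesis using trib_num_gt[of n] by (simp add: x_def trib_num_def nth_append)
  next
    case False
    then obtain k where k: "n = m + k" using le_Suc_ex nat_le_linear by blast
    obtain v where "(subst ^^ n) [La] = (subst ^^ m) [La] @ v"
      using iter_subst_mono k by blast
    then show ?thesis using that by (simp add: x_def trib_num_def nth_append)
  qed
  have pre: "\<exists>s. x = (subst ^^ m) [La] @- s" for m
  proof -
    have "stake (trib_num m) x = (subst ^^ m) [La]"
      by (rule nth_equalityI) (auto simp: trib_num_def nth)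
    then have "x = (subst ^^ m) [La] @- sdrop (trib_num m) x"
      by (metis stake_sdrop)
    then show ?thesis by (rule exI)
  qed
  have pre': "\<exists>s. subst_inf x = (subst ^^ m) [La] @- s" for m
  proof -
    obtain s where "x = (subst ^^ m) [La] @- s" using pre by blast
    then have "subst_inf x = (subst ^^ Suc m) [La] @- subst_inf s"
      by (simp add: subst_inf_shift)
    moreover obtain v where "(subst ^^ Suc m) [La] = (subst ^^ m) [La] @ v"
      using iter_subst_Suc by blast
    ultimately have "subst_inf x = (subst ^^ m) [La] @- (v @- subst_inf s)"
      by (simp only: shift_append)
    then show ?thesis by blast
  qed
  have "subst_inf x !! n = x !! n" for n
    by (simp only: fixed_point_snth[OF pre'] fixed_point_snth[OF pre])
  then have "subst_inf x = x" by (rule stream_eqI)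
  moreover have "shd x = La" by (simp add: x_def)
  ultimately show "\<exists>x. subst_inf x = x \<and> shd x = La" by blast
next
  fix x y
  assume x: "subst_inf x = x \<and> shd x = La" and y: "subst_inf y = y \<and> shd y = La"
  have "x !! n = (subst ^^ n) [La] ! n" "y !! n = (subst ^^ n) [La] ! n" for n
    using x y by (auto intro!: fixed_point_snth fixed_point_prefix)
  then have "x !! n = y !! n" for n by simp
  then show "x = y" by (rule stream_eqI)
qed

lemma tribonacci_fixed_point: "subst_inf tribonacci = tribonacci"
  and tribonacci_shd: "shd tribonacci = La"
  using theI'[OF tribonacci_ex1] unfolding tribonacci_def by blast+

lemma finite_squares_in_prefix: "finite (squares_in_prefix n)"
proof (rule finite_subset)
  let ?f = "\<lambda>(i, l). let w = stake l (sdrop (i - 1) tribonacci) in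
    (w, card {j. j \<le> i \<and> occurs_at w j})"
  show "squares_in_prefix n \<subseteq> ?f ` ({..n} \<times> {..n})"
  proof
    fix q assume "q \<in> squares_in_prefix n"
    then obtain w p i where q: "q = (w, p)" "w \<noteq> []" "square_at w p i"
      "i + 2 * length w - 1 \<le> n"
      unfolding squares_in_prefix_def by blast
    then have "stake (length w) (sdrop (i - 1) tribonacci) = w"
      "card {j. j \<le> i \<and> occurs_at w j} = p"
      unfolding square_at_def nth_occurrence_def occurs_at_def by blast+
    then have "q = ?f (i, length w)" using q(1) by (simp add: Let_def)
    moreover have "0 < length w" using q(2) by simp
    then have "i \<le> n" "length w \<le> n" using q(4) by linarith+
    ultimately show "q \<in> ?f ` ({..n} \<times> {..n})" by blast
  qed
qed simp

end

(*
  Every block sigma(d) contains exactly one a, at its start, so the word desubstitutes uniquely.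
  For a period p, consider the maximal intervals of positions i with T[i] = T[i + p].  The
  substitution maps such an interval, with v positions starting at s, to one starting at P s with
  P(s + v) - P s + 1 positions, where P n is the length of sigma(T[0, n)); conversely every
  nonempty interval arises in this way.  Iterating, every interval comes from an empty one, and its
  length depends only on the number k of iterations.  A length comparison shows that it
  can be long enough to contain a square only if the initial period is 1, so the period is
  |sigma^k(d)| for a letter d that differs from both its neighbours.  Hence A(t_m) is the sum over
  k < m of counts of such letters in the prefix of length t_(m-k), each weighted by the number of
  squares in its interval.  Only the last two letters of the prefix contribute less than
  their full weight, in a way that depends on (m - k) mod 3.  Both the full sum and the
  correction then satisfy linear recurrences in m.
*)

theory Submission
  imports Defs
begin

section \<open>Desubstitution: blocks and their starting positions\<close>

definition trib :: "nat \<Rightarrow> letter" where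
  "trib i = tribonacci !! i"

definition block_start :: "nat \<Rightarrow> nat" where
  "block_start n = length (subst (stake n tribonacci))"

text \<open>The last letter of \<open>sigma d\<close>. It is also the letter that follows the
  initial \<open>a\<close> of a block \<open>sigma d\<close>: for \<open>d = Lc\<close> the block
  has length one and the next letter is the \<open>a\<close> of the next block. Since
  \<open>rot\<close> is injective, a mismatch of two letters survives the substitution on either
  side.\<close>

fun rot :: "letter \<Rightarrow> letter" where
  "rot La = Lb"
| "rot Lb = Lc"
| "rot Lc = La"

lemma rot_inject [simp]: "rot d = rot e \<longleftrightarrow> d = e"
  by (cases d; cases e) auto

lemma rot_eq_La [simp]: "rot d = La \<longleftrightarrow> d = Lc"
  by (cases d) auto

lemma block_start_0 [simp]: "block_start 0 = 0"
  by (simp add: block_start_def subst_def)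

lemma block_start_Suc: "block_start (Suc n) = block_start n + length (sigma (trib n))"
  unfolding block_start_def stake_Suc trib_def by (simp add: subst_append) (simp add: subst_def)

lemma block_start_Suc_cases:
  "block_start (Suc n) = block_start n + (if trib n = Lc then 1 else 2)"
  by (cases "trib n") (auto simp: block_start_Suc)

text \<open>Cutting the word after \<open>n\<close> letters and substituting in both halves gives
  the word back, because it is a fixed point.\<close>

lemma sdrop_block_start:
  "sdrop (block_start n) tribonacci = subst_inf (sdrop n tribonacci)"
proof -
  have "tribonacci = subst_inf (stake n tribonacci @- sdrop n tribonacci)"
    by (simp add: stake_sdrop tribonacci_fixed_point)
  then have "tribonacci = subst (stake n tribonacci) @- subst_inf (sdrop n tribonacci)"
    by (simp only: subst_inf_shift)
  then have "sdrop (block_start n) tribonacci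
      = sdrop (block_start n) (subst (stake n tribonacci) @- subst_inf (sdrop n tribonacci))"
    by (rule arg_cong)
  then show ?thesis
    by (simp add: block_start_def sdrop_shift)
qed

lemma subst_inf_SCons: "subst_inf (d ## s) = sigma d @- subst_inf s"
  using subst_inf_shift[of "[d]" s] by (simp add: subst_def)

lemma trib_block_start_add:
  assumes "r < length (sigma (trib n))"
  shows "trib (block_start n + r) = sigma (trib n) ! r"
proof -
  have "sdrop n tribonacci = trib n ## sdrop (Suc n) tribonacci"
    using stream.collapse[of "sdrop n tribonacci"] by (simp add: sdrop_simps trib_def)
  then have "sdrop (block_start n) tribonacci
      = sigma (trib n) @- subst_inf (sdrop (Suc n) tribonacci)"
    by (simp only: sdrop_block_start subst_inf_SCons)
  then show ?thesis
    using assms sdrop_snth[of "block_start n" tribonacci r] by (simp add: shift_snth_less trib_def)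
qed

lemma trib_block_start [simp]: "trib (block_start n) = La"
  using trib_block_start_add[of 0 n] by (cases "trib n") auto

lemma trib_0 [simp]: "trib 0 = La"
  by (metis trib_block_start block_start_0)

lemma trib_Suc_block_start [simp]: "trib (Suc (block_start n)) = rot (trib n)"
proof (cases "trib n = Lc")
  case True
  then have "Suc (block_start n) = block_start (Suc n)" by (simp add: block_start_Suc_cases)
  with True show ?thesis by (metis trib_block_start rot.simps(3))
next
  case False
  then show ?thesis
    using trib_block_start_add[of 1 n] by (cases "trib n") auto
qed

lemma trib_before_block_start [simp]: "trib (block_start (Suc n) - 1) = rot (trib n)"
  using trib_Suc_block_start[of n] trib_block_start[of n]
  by (cases "trib n") (simp_all add: block_start_Suc_cases)

lemma strict_mono_block_start: "strict_mono block_start"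
  by (rule strict_mono_Suc_iff[THEN iffD2]) (simp add: block_start_Suc_cases)

lemma block_start_less_iff [simp]: "block_start a < block_start b \<longleftrightarrow> a < b"
  by (rule strict_mono_less[OF strict_mono_block_start])

lemma block_start_le_iff [simp]: "block_start a \<le> block_start b \<longleftrightarrow> a \<le> b"
  by (rule strict_mono_less_eq[OF strict_mono_block_start])

lemma block_start_eq_iff [simp]: "block_start a = block_start b \<longleftrightarrow> a = b"
  by (rule strict_mono_eq[OF strict_mono_block_start])

lemma block_cases:
  obtains (first) n where "i = block_start n"
  | (second) n where "i = Suc (block_start n)" "trib n \<noteq> Lc"
proof -
  have "(\<exists>n. i = block_start n) \<or> (\<exists>n. i = Suc (block_start n) \<and> trib n \<noteq> Lc)"
  proof (induction i)
    case 0
    show ?case by (rule disjI1, rule exI[of _ 0]) simp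
  next
    case (Suc i)
    then show ?case
    proof (elim disjE exE conjE)
      fix n assume "i = block_start n"
      then show ?thesis
        by (cases "trib n = Lc") (metis Suc_eq_plus1 block_start_Suc_cases, blast)
    next
      fix n assume "i = Suc (block_start n)" "trib n \<noteq> Lc"
      then have "Suc i = block_start (Suc n)" by (simp add: block_start_Suc_cases)
      then show ?thesis by blast
    qed
  qed
  then show thesis using first second by blast
qed

lemma trib_La_E:
  assumes "trib i = La" obtains n where "i = block_start n"
  using assms by (cases i rule: block_cases) auto

lemma trib_La_before:
  assumes "trib i \<noteq> La"
  shows "0 < i" "trib (i - 1) = La"
  using assms by (cases i rule: block_cases; auto)+

lemma trib_La_after:
  assumes "trib i \<noteq> La" shows "trib (Suc i) = La"
  using assms trib_La_before[of "Suc i"] by auto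

lemma block_start_ge: "n \<le> block_start n"
  by (rule strict_mono_imp_increasing[OF strict_mono_block_start])

lemma block_start_eq_0_iff [simp]: "block_start n = 0 \<longleftrightarrow> n = 0"
  by (metis block_start_0 block_start_eq_iff)

section \<open>Maximal runs\<close>

definition periodic_run :: "nat \<Rightarrow> nat \<Rightarrow> nat \<Rightarrow> bool" where
  "periodic_run s v p \<longleftrightarrow> 1 \<le> p \<and> (\<forall>i. s \<le> i \<and> i < s + v \<longrightarrow> trib i = trib (i + p)) \<and>
     trib (s + v) \<noteq> trib (s + v + p) \<and> (0 < s \<longrightarrow> trib (s - 1) \<noteq> trib (s - 1 + p))"

text \<open>Equal words have images of equal length. The additive form avoids truncated
  subtraction.\<close>

lemma block_start_diff_eq:
  assumes "\<And>i. i < v \<Longrightarrow> trib (s + i) = trib (s' + i)" "j \<le> v"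
  shows "block_start (s + j) + block_start s' = block_start (s' + j) + block_start s"
  using assms(2)
proof (induction j)
  case (Suc j)
  then show ?case using assms(1)[of j] by (simp add: block_start_Suc_cases)
qed simp

text \<open>Equal words have equal images, and the agreement extends one letter further, to the
  position \<open>block_start (s + v)\<close> itself, because the next block begins with
  \<open>a\<close> in both places.\<close>

lemma trib_image_eq:
  assumes eq: "\<And>i. i < v \<Longrightarrow> trib (s + i) = trib (s' + i)"
    and j: "block_start s + j \<le> block_start (s + v)"
  shows "trib (block_start s + j) = trib (block_start s' + j)"
proof (cases "block_start s + j" rule: block_cases)
  case (first n)
  then have "block_start s \<le> block_start n" "block_start n \<le> block_start (s + v)"
    using j by linarith+
  then have "s \<le> n" "n \<le> s + v" by simp_all
  then obtain i where i: "n = s + i" "i \<le> v" by (metis le_Suc_ex nat_add_left_cancel_le)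
  have d: "block_start (s + i) + block_start s' = block_start (s' + i) + block_start s"
    by (rule block_start_diff_eq[OF eq i(2)])
  have "block_start s' + j = block_start (s' + i)"
    using d first i(1) by simp
  then show ?thesis using first by simp
next
  case (second n)
  have "s \<le> n"
  proof (rule ccontr)
    assume "\<not> s \<le> n"
    then have "block_start (Suc n) \<le> block_start s" by simp
    then show False using second unfolding block_start_Suc_cases by simp
  qed
  moreover have "n < s + v"
  proof -
    have "block_start n < block_start (s + v)" using second(1) j by linarith
    then show ?thesis by simp
  qed
  ultimately obtain i where i: "n = s + i" "i < v" by (metis le_Suc_ex nat_add_left_cancel_less)
  have d: "block_start (s + i) + block_start s' = block_start (s' + i) + block_start s"
    using block_start_diff_eq[of v s s' i] eq less_imp_le[OF i(2)] by blast
  have "block_start s' + j = Suc (block_start (s' + i))"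
    using d second(1) i(1) by simp
  then show ?thesis using second(1) i(1) eq[OF i(2)] by simp
qed

text \<open>The additional position is the \<open>a\<close> that opens the next block on both sides.
  The mismatch on the right becomes a mismatch of the letters after these two \<open>a\<close>s, and
  the one on the left a mismatch of the last letters of the preceding blocks; both are obtained from
  injectivity of \<open>rot\<close>.\<close>

lemma periodic_run_image:
  assumes "periodic_run s v p"
  shows "periodic_run (block_start s) (Suc (block_start (s + v) - block_start s))
           (block_start (s + p) - block_start s)"
proof -
  define V where "V = block_start (s + v) - block_start s"
  define q where "q = block_start (s + p) - block_start s"
  have p: "1 \<le> p" and eq0: "\<And>i. s \<le> i \<Longrightarrow> i < s + v \<Longrightarrow> trib i = trib (i + p)"
    and ne: "trib (s + v) \<noteq> trib (s + v + p)"
    and left: "0 < s \<Longrightarrow> trib (s - 1) \<noteq> trib (s - 1 + p)"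
    using assms unfolding periodic_run_def by blast+
  have eq: "trib (s + i) = trib (s + p + i)" if "i < v" for i
    using eq0[of "s + i"] that by (simp add: ac_simps)
  have V: "block_start s + V = block_start (s + v)" unfolding V_def by simp
  have q: "block_start s + q = block_start (s + p)" unfolding q_def by simp
  show ?thesis
    unfolding periodic_run_def V_def[symmetric] q_def[symmetric]
  proof (intro conjI allI impI; (elim conjE)?)
    show "1 \<le> q" using p unfolding q_def by (simp add: Suc_le_eq)
  next
    fix i assume i: "block_start s \<le> i" "i < block_start s + Suc V"
    obtain j where j: "i = block_start s + j" using i(1) le_iff_add by blast
    have "block_start s + j \<le> block_start (s + v)" using i(2) j V by linarith
    then have "trib (block_start s + j) = trib (block_start (s + p) + j)"
      using trib_image_eq[of v s "s + p" j] eq by blast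
    moreover have "i + q = block_start (s + p) + j" using j q by linarith
    ultimately show "trib i = trib (i + q)" using j by metis
  next
    have "block_start (s + v) + block_start (s + p) = block_start (s + p + v) + block_start s"
      using block_start_diff_eq[of v s "s + p" v] eq by blast
    then have "block_start (s + v) + block_start (s + p) = block_start (s + v + p) + block_start s"
      by (simp only: ac_simps)
    then have "block_start s + Suc V + q = Suc (block_start (s + v + p))"
      using V q by linarith
    moreover have "block_start s + Suc V = Suc (block_start (s + v))" using V by linarith
    ultimately show "trib (block_start s + Suc V) \<noteq> trib (block_start s + Suc V + q)"
      using ne by (metis trib_Suc_block_start rot_inject)
  next
    assume pos: "0 < block_start s"
    then obtain s0 where s: "s = Suc s0" by (cases s) auto
    have "block_start s - 1 + q = block_start (Suc (s0 + p)) - 1"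
      using pos q by (simp add: s)
    then show "trib (block_start s - 1) \<noteq> trib (block_start s - 1 + q)"
      using left s by (metis trib_before_block_start rot_inject diff_Suc_1 zero_less_Suc)
  qed
qed

lemma periodic_run_preimage:
  assumes "periodic_run s v p" "0 < v"
  obtains s' v' p' where "periodic_run s' v' p'" "s = block_start s'"
    "v = Suc (block_start (s' + v') - block_start s')"
    "p = block_start (s' + p') - block_start s'"
proof -
  have p: "1 \<le> p" and eq: "\<And>i. s \<le> i \<Longrightarrow> i < s + v \<Longrightarrow> trib i = trib (i + p)"
    and ne: "trib (s + v) \<noteq> trib (s + v + p)"
    and left: "0 < s \<Longrightarrow> trib (s - 1) \<noteq> trib (s - 1 + p)"
    using assms(1) unfolding periodic_run_def by blast+
  \<comment> \<open>A letter other than \<open>a\<close> is preceded by \<open>a\<close>, in both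
    copies, so the run could be extended to the left.\<close>
  have s_La: "trib s = La"
  proof (rule ccontr)
    assume "trib s \<noteq> La"
    moreover from this have "trib (s + p) \<noteq> La" using eq[of s] assms(2) by simp
    ultimately show False
      using trib_La_before[of s] trib_La_before[of "s + p"] left by simp
  qed
  obtain s' where s': "s = block_start s'" using s_La by (rule trib_La_E)
  have "trib (s + p) = La" using eq[of s] s_La assms(2) by simp
  then obtain g where g: "s + p = block_start g" by (rule trib_La_E)
  then have "block_start s' < block_start g" using p s' by linarith
  then have "s' < g" by simp
  define p' where "p' = g - s'"
  have p': "1 \<le> p'" "block_start s' + p = block_start (s' + p')"
    using \<open>s' < g\<close> g s' unfolding p'_def by simp_all
  \<comment> \<open>Likewise a letter other than \<open>a\<close> is followed by \<open>a\<close> in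
    both copies, so the run cannot end on it.\<close>
  have e_La: "trib (s + v - 1) = La"
  proof (rule ccontr)
    assume n: "trib (s + v - 1) \<noteq> La"
    moreover have "trib (s + v - 1) = trib (s + v - 1 + p)" using eq assms(2) by simp
    ultimately show False
      using trib_La_after[of "s + v - 1"] trib_La_after[of "s + v - 1 + p"] ne assms(2) by simp
  qed
  then obtain e' where e': "s + v - 1 = block_start e'" by (rule trib_La_E)
  have "block_start s' \<le> block_start e'" using e' s' assms(2) by linarith
  then have "s' \<le> e'" by simp
  define v' where "v' = e' - s'"
  have v': "e' = s' + v'" using \<open>s' \<le> e'\<close> unfolding v'_def by simp
  \<comment> \<open>Induction over the blocks: the position after the start of a block still lies in
    the run, and its letter is \<open>rot\<close> of the letter that generates the block. Hence the
    generating letters agree at distance \<open>p'\<close>, and so do the block lengths.\<close>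
  have shift: "block_start (s' + j) + p = block_start (s' + j + p') \<and>
      (\<forall>i<j. trib (s' + i) = trib (s' + i + p'))" if "j \<le> v'" for j
    using that
  proof (induction j)
    case 0
    show ?case using p' by simp
  next
    case (Suc j)
    then have IH: "block_start (s' + j) + p = block_start (s' + j + p')"
      "\<forall>i<j. trib (s' + i) = trib (s' + i + p')" by auto
    have "block_start (Suc (s' + j)) \<le> block_start e'" using Suc.prems v' by simp
    then have "Suc (block_start (s' + j)) < s + v"
      unfolding block_start_Suc_cases using e' assms(2) by (simp split: if_splits)
    moreover have "block_start s' \<le> block_start (s' + j)" by simp
    ultimately have "trib (Suc (block_start (s' + j))) = trib (Suc (block_start (s' + j)) + p)"
      using s' by (intro eq) linarith+
    also have "Suc (block_start (s' + j)) + p = Suc (block_start (s' + j + p'))"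
      using IH(1) by linarith
    finally have same: "trib (s' + j) = trib (s' + j + p')" by simp
    moreover have "block_start (s' + Suc j) + p = block_start (s' + Suc j + p')"
      using IH(1) same unfolding add_Suc_right add_Suc block_start_Suc_cases by simp
    ultimately show ?case using IH(2) by (auto simp: less_Suc_eq)
  qed
  have "periodic_run s' v' p'"
    unfolding periodic_run_def
  proof (intro conjI allI impI; (elim conjE)?)
    show "1 \<le> p'" by (rule p')
  next
    fix i assume "s' \<le> i" "i < s' + v'"
    then show "trib i = trib (i + p')" using shift[of v'] by (metis le_Suc_ex nat_add_left_cancel_less order_refl)
  next
    have "s + v = Suc (block_start (s' + v'))" using e' assms(2) unfolding v' by linarith
    moreover from this have "s + v + p = Suc (block_start (s' + v' + p'))" using shift[of v'] by simp
    ultimately show "trib (s' + v') \<noteq> trib (s' + v' + p')" using ne by simp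
  next
    assume pos: "0 < s'"
    then obtain s0 where s0: "s' = Suc s0" by (cases s') auto
    have "0 < s" using pos s' by (metis block_start_eq_0_iff neq0_conv)
    moreover have "s - 1 + p = block_start (Suc (s0 + p')) - 1"
      using \<open>0 < s\<close> p' s' s0 by simp
    ultimately show "trib (s' - 1) \<noteq> trib (s' - 1 + p')"
      using left s' s0 trib_before_block_start[of s0] trib_before_block_start[of "s0 + p'"] by simp
  qed
  moreover have "v = Suc (block_start (s' + v') - block_start s')"
    using e' assms(2) unfolding v' s' by linarith
  moreover have "p = block_start (s' + p') - block_start s'" using p' by linarith
  ultimately show thesis using that s' by blast
qed

text \<open>Descent on the period: an eventual period \<open>p\<close> desubstitutes to an eventual
  period \<open>p'\<close>, which cannot be smaller than \<open>p\<close> by induction. As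
  substitution lengthens every word containing a letter other than \<open>c\<close>, the tail would
  then consist of \<open>c\<close> only.\<close>

lemma not_eventually_periodic:
  assumes "1 \<le> p" shows "\<exists>i\<ge>s. trib i \<noteq> trib (i + p)"
  using assms
proof (induction p arbitrary: s rule: less_induct)
  case (less p)
  show ?case
  proof (rule ccontr)
    assume "\<not> ?thesis"
    then have eq: "\<And>i. s \<le> i \<Longrightarrow> trib i = trib (i + p)" by blast
    have start: "s \<le> block_start s" by (rule block_start_ge)
    have "trib (block_start s + p) = La" using eq[OF start] by simp
    then obtain g where g: "block_start s + p = block_start g" by (rule trib_La_E)
    then have "block_start s < block_start g" using less.prems by linarith
    then have "s < g" by simp
    define p' where "p' = g - s"
    have p': "1 \<le> p'" "block_start s + p = block_start (s + p')"
      using \<open>s < g\<close> g unfolding p'_def by simp_all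
    have step: "trib (s + j) = trib (s + j + p')"
      if "block_start (s + j) + p = block_start (s + j + p')" for j
    proof -
      have "block_start s \<le> block_start (s + j)" by simp
      then have "trib (Suc (block_start (s + j))) = trib (Suc (block_start (s + j)) + p)"
        using start by (intro eq) linarith
      also have "Suc (block_start (s + j)) + p = Suc (block_start (s + j + p'))"
        using that by linarith
      finally show ?thesis by simp
    qed
    have shift: "block_start (s + j) + p = block_start (s + j + p')" for j
    proof (induction j)
      case 0
      show ?case using p' by simp
    next
      case (Suc j)
      show ?case using step[OF Suc] Suc unfolding add_Suc_right add_Suc block_start_Suc_cases by simp
    qed
    have same: "trib (s + j) = trib (s + j + p')" for j by (rule step[OF shift])
    have "\<not> (\<exists>i\<ge>s. trib i \<noteq> trib (i + p'))"
    proof (intro notI, elim exE conjE)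
      fix i assume "s \<le> i" "trib i \<noteq> trib (i + p')"
      then show False using same[of "i - s"] by simp
    qed
    then have p'_ge: "\<not> p' < p" using less.IH p'(1) by blast
    \<comment> \<open>Every letter other than \<open>c\<close> adds one to the length of the
      image.\<close>
    have growth: "block_start n + j + card {i. n \<le> i \<and> i < n + j \<and> trib i \<noteq> Lc}
        \<le> block_start (n + j)" for n j
    proof (induction j)
      case (Suc j)
      have "{i. n \<le> i \<and> i < n + Suc j \<and> trib i \<noteq> Lc}
          = (if trib (n + j) = Lc then {i. n \<le> i \<and> i < n + j \<and> trib i \<noteq> Lc}
             else insert (n + j) {i. n \<le> i \<and> i < n + j \<and> trib i \<noteq> Lc})"
        by (auto simp: less_Suc_eq)
      then show ?case using Suc by (simp add: block_start_Suc_cases)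
    qed simp
    have c: "trib i = Lc" if "s \<le> i" for i
    proof -
      have "block_start (i + p') = block_start i + p" using shift[of "i - s"] that by simp
      then have "card {h. i \<le> h \<and> h < i + p' \<and> trib h \<noteq> Lc} = 0"
        using growth[of i p'] p'_ge by linarith
      then have "{h. i \<le> h \<and> h < i + p' \<and> trib h \<noteq> Lc} = {}" by simp
      moreover have "i < i + p'" using p'(1) by simp
      ultimately show ?thesis by blast
    qed
    have "trib (block_start s) = Lc" by (rule c[OF block_start_ge])
    then show False by simp
  qed
qed

section \<open>Lengths\<close>

definition letter_count :: "letter \<Rightarrow> nat \<Rightarrow> nat" where
  "letter_count d n = (\<Sum>i<n. if trib i = d then 1 else 0)"

lemma letter_count_0 [simp]: "letter_count d 0 = 0"
  by (simp add: letter_count_def)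

lemma letter_count_Suc:
  "letter_count d (Suc n) = letter_count d n + (if trib n = d then 1 else 0)"
  by (simp add: letter_count_def)

lemma letter_count_sum: "letter_count La n + letter_count Lb n + letter_count Lc n = n"
proof (induction n)
  case (Suc n)
  then show ?case by (cases "trib n") (simp_all add: letter_count_Suc)
qed simp

lemma letter_count_block_start [simp]:
  "letter_count La (block_start n) = n"
  "letter_count Lb (block_start n) = letter_count La n"
  "letter_count Lc (block_start n) = letter_count Lb n"
proof -
  have "letter_count La (block_start n) = n \<and> letter_count Lb (block_start n) = letter_count La n \<and>
      letter_count Lc (block_start n) = letter_count Lb n"
  proof (induction n)
    case (Suc n)
    then show ?case
      by (cases "trib n") (simp_all add: letter_count_Suc block_start_Suc_cases)
  qed simp
  then show "letter_count La (block_start n) = n"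
    "letter_count Lb (block_start n) = letter_count La n"
    "letter_count Lc (block_start n) = letter_count Lb n" by simp_all
qed

lemma block_start_add_letter_count: "block_start n + letter_count Lc n = 2 * n"
  by (induction n) (auto simp: letter_count_Suc block_start_Suc_cases)

lemma block_start_counts: "block_start n = n + letter_count La n + letter_count Lb n"
  using block_start_add_letter_count[of n] letter_count_sum[of n] by linarith

fun letter_len :: "letter \<Rightarrow> nat \<Rightarrow> nat" where
  "letter_len d 0 = 1"
| "letter_len La (Suc k) = letter_len La k + letter_len Lb k"
| "letter_len Lb (Suc k) = letter_len La k + letter_len Lc k"
| "letter_len Lc (Suc k) = letter_len La k"

lemma letter_len_Suc: "letter_len d (Suc k) = sum_list (map (\<lambda>e. letter_len e k) (sigma d))"
  by (cases d) simp_all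

lemma letter_len_pos [simp]: "0 < letter_len d k"
  by (induction d k rule: letter_len.induct) auto

lemma letter_len_rec:
  "letter_len d (k + 3) = letter_len d (k + 2) + letter_len d (k + 1) + letter_len d k"
  by (cases d) (simp_all add: numeral_eq_Suc)

lemma length_iter_subst:
  "length ((subst ^^ k) w) = sum_list (map (\<lambda>d. letter_len d k) w)"
proof (induction k arbitrary: w)
  case 0
  show ?case by (induction w) auto
next
  case (Suc k)
  have "length ((subst ^^ Suc k) w) = sum_list (map (\<lambda>d. letter_len d k) (subst w))"
    by (simp only: funpow_Suc_right comp_apply Suc)
  also have "\<dots> = sum_list (map (\<lambda>d. letter_len d (Suc k)) w)"
    by (induction w) (simp_all add: subst_def letter_len_Suc del: letter_len.simps)
  finally show ?case .
qed

lemma trib_num_eq: "trib_num m = letter_len La m"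
  by (simp add: trib_num_def length_iter_subst)

section \<open>Iterated images of prefixes and of empty runs\<close>

abbreviation iter_start :: "nat \<Rightarrow> nat \<Rightarrow> nat" where
  "iter_start k \<equiv> block_start ^^ k"

lemma iter_start_Suc: "iter_start k (Suc s) = iter_start k s + letter_len (trib s) k"
proof (induction k arbitrary: s)
  case (Suc k)
  have *: "iter_start (Suc k) n = iter_start k (block_start n)" for n
    by (simp add: funpow_swap1)
  show ?case
  proof (cases "trib s")
    case La
    then have "block_start (Suc s) = Suc (Suc (block_start s))" by (simp add: block_start_Suc_cases)
    then show ?thesis unfolding * using La by (simp add: Suc)
  next
    case Lb
    then have "block_start (Suc s) = Suc (Suc (block_start s))" by (simp add: block_start_Suc_cases)
    then show ?thesis unfolding * using Lb by (simp add: Suc)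
  next
    case Lc
    then have "block_start (Suc s) = Suc (block_start s)" by (simp add: block_start_Suc_cases)
    then show ?thesis unfolding * using Lc by (simp add: Suc)
  qed
qed simp

lemma strict_mono_iter_start: "strict_mono (iter_start k)"
  by (rule strict_mono_Suc_iff[THEN iffD2]) (simp add: iter_start_Suc)

lemma iter_start_0 [simp]: "iter_start k 0 = 0"
  by (induction k) auto

lemma iter_start_1: "iter_start k 1 = trib_num k"
  using iter_start_Suc[of k 0] by (simp add: trib_num_eq)

text \<open>The number of positions in the \<open>k\<close>-th image of an empty run. It can be
  computed at the origin because, by \<open>run_prefix\<close>, every such run reads a prefix of the
  word.\<close>

definition run_len :: "nat \<Rightarrow> nat" where
  "run_len k = ((\<lambda>n. Suc (block_start n)) ^^ k) 0"

lemma run_len_0 [simp]: "run_len 0 = 0"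
  and run_len_Suc: "run_len (Suc k) = Suc (block_start (run_len k))"
  by (simp_all add: run_len_def)

text \<open>The prefix of length \<open>run_len (Suc j)\<close> is the image of the prefix of length
  \<open>run_len j\<close> followed by one \<open>a\<close>. This determines its numbers of
  \<open>a\<close> and \<open>b\<close>, to which \<open>block_start_counts\<close> applies.\<close>

lemma run_len_rec: "run_len (k + 3) = run_len (k + 2) + run_len (k + 1) + run_len k + 3"
proof -
  have a: "letter_count La (run_len (Suc j)) = Suc (run_len j)" for j
    by (simp add: run_len_Suc letter_count_Suc)
  have b: "letter_count Lb (run_len (Suc j)) = letter_count La (run_len j)" for j
    by (simp add: run_len_Suc letter_count_Suc)
  have "run_len (Suc (Suc (Suc k))) = Suc (block_start (run_len (Suc (Suc k))))"
    by (rule run_len_Suc)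
  also have "\<dots> = run_len (Suc (Suc k)) + run_len (Suc k) + run_len k + 3"
    unfolding block_start_counts[of "run_len (Suc (Suc k))"] a b by simp
  finally show ?thesis by (simp add: numeral_eq_Suc)
qed

text \<open>All images begin with \<open>a\<close>, so a common prefix of \<open>v\<close> letters
  of two suffixes grows to one of \<open>block_start v + 1\<close> letters under the
  substitution.\<close>

lemma run_prefix:
  assumes "i < run_len k" shows "trib (iter_start k s + i) = trib i"
  using assms
proof (induction k arbitrary: i s)
  case (Suc k)
  have "trib (block_start (iter_start k s) + i) = trib (block_start 0 + i)"
  proof (rule trib_image_eq)
    show "trib (iter_start k s + j) = trib (0 + j)" if "j < run_len k" for j
      using Suc.IH[OF that] by simp
    show "block_start (iter_start k s) + i \<le> block_start (iter_start k s + run_len k)"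
    proof -
      have "block_start (iter_start k s + run_len k) + block_start 0
          = block_start (0 + run_len k) + block_start (iter_start k s)"
        by (rule block_start_diff_eq[of "run_len k"]) (use Suc.IH in auto)
      then show ?thesis using Suc.prems by (simp add: run_len_Suc)
    qed
  qed
  then show ?case by simp
qed simp

lemma block_start_run_len:
  "block_start (iter_start k s + run_len k) = block_start (iter_start k s) + block_start (run_len k)"
proof -
  have "block_start (iter_start k s + run_len k) + block_start 0
      = block_start (0 + run_len k) + block_start (iter_start k s)"
    by (rule block_start_diff_eq[of "run_len k"]) (use run_prefix in auto)
  then show ?thesis by simp
qed

lemma periodic_run_iter:
  assumes "periodic_run s 0 p"
  shows "periodic_run (iter_start k s) (run_len k) (iter_start k (s + p) - iter_start k s)"
proof (induction k)
  case 0
  show ?case using assms by simp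
next
  case (Suc k)
  have "iter_start k s \<le> iter_start k (s + p)"
    using strict_mono_iter_start by (simp add: strict_mono_less_eq)
  with periodic_run_image[OF Suc] show ?case
    by (simp add: block_start_run_len run_len_Suc)
qed

text \<open>Descent on \<open>v\<close>: the preimage of a nonempty run has strictly fewer
  positions.\<close>

lemma periodic_run_obtain:
  assumes "periodic_run s v p"
  obtains k s0 p0 where "periodic_run s0 0 p0" "s = iter_start k s0" "v = run_len k"
    "p = iter_start k (s0 + p0) - iter_start k s0"
proof -
  have "\<exists>k s0 p0. periodic_run s0 0 p0 \<and> s = iter_start k s0 \<and> v = run_len k \<and>
    p = iter_start k (s0 + p0) - iter_start k s0"
    using assms
  proof (induction v arbitrary: s p rule: less_induct)
    case (less v)
    show ?case
    proof (cases "v = 0")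
      case True
      with less.prems show ?thesis
        by (intro exI[of _ 0] exI[of _ s] exI[of _ p]) simp
    next
      case False
      then obtain s' v' p' where *: "periodic_run s' v' p'" "s = block_start s'"
        "v = Suc (block_start (s' + v') - block_start s')"
        "p = block_start (s' + p') - block_start s'"
        using periodic_run_preimage[OF less.prems] by blast
      have "v' \<le> block_start (s' + v') - block_start s'"
      proof (induction v')
        case (Suc n)
        have "block_start s' \<le> block_start (s' + n)" by simp
        moreover have "Suc (block_start (s' + n)) \<le> block_start (s' + Suc n)"
          by (simp add: block_start_Suc_cases)
        ultimately show ?case using Suc by linarith
      qed simp
      then have "v' < v" using *(3) by linarith
      from less.IH[OF this *(1)] obtain k s0 p0 where
        k: "periodic_run s0 0 p0" "s' = iter_start k s0" "v' = run_len k"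
        "p' = iter_start k (s0 + p0) - iter_start k s0" by blast
      have "iter_start k s0 \<le> iter_start k (s0 + p0)"
        using strict_mono_iter_start by (simp add: strict_mono_less_eq)
      then have "s = iter_start (Suc k) s0" "v = run_len (Suc k)"
        "p = iter_start (Suc k) (s0 + p0) - iter_start (Suc k) s0"
        using * k by (simp_all add: block_start_run_len run_len_Suc)
      with k(1) show ?thesis by blast
    qed
  qed
  then show thesis using that by blast
qed

lemma induct3 [case_names 0 1 2 step]:
  fixes P :: "nat \<Rightarrow> bool"
  assumes "P 0" "P 1" "P 2"
    and "\<And>n. P n \<Longrightarrow> P (n + 1) \<Longrightarrow> P (n + 2) \<Longrightarrow> P (n + 3)"
  shows "P n"
proof -
  have "P n \<and> P (n + 1) \<and> P (n + 2)"
  proof (induction n)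
    case 0
    show ?case using assms(1-3) by (simp add: numeral_eq_Suc)
  next
    case (Suc n)
    then show ?case using assms(4)[of n] by (simp add: numeral_eq_Suc)
  qed
  then show ?thesis ..
qed

lemma run_len_simps [simp]: "run_len (Suc 0) = 1" "run_len 2 = 3"
proof -
  show 1: "run_len (Suc 0) = 1" using run_len_Suc[of 0] by simp
  have "block_start 1 = 2" using block_start_Suc_cases[of 0] by simp
  then show "run_len 2 = 3" using run_len_Suc[of "Suc 0"] 1 by (simp add: numeral_eq_Suc)
qed

lemma letter_len_simps [simp]:
  "letter_len d (Suc 0) = (if d = Lc then 1 else 2)"
  "letter_len d 2 = (case d of La \<Rightarrow> 4 | Lb \<Rightarrow> 3 | Lc \<Rightarrow> 2)"
  by (cases d; simp add: numeral_eq_Suc)+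

text \<open>The sequence \<open>2 * run_len k + 3\<close> satisfies the homogeneous Tribonacci
  recurrence and starts with 3, 5, 9, so comparing three initial values suffices.\<close>

lemma run_len_le_tribonacci_like:
  fixes g :: "nat \<Rightarrow> nat"
  assumes g: "\<And>n. g (n + 3) = g (n + 2) + g (n + 1) + g n"
    and base: "3 \<le> g 0" "5 \<le> g (Suc 0)" "9 \<le> g 2"
  shows "2 * run_len k + 3 \<le> g k"
proof (induction k rule: induct3)
  case (step k)
  then show ?case using run_len_rec[of k] g[of k] by linarith
qed (use base in simp_all)

text \<open>Of two adjacent letters at least one is \<open>a\<close>, so a run has fewer positions
  than the image of two adjacent letters has letters.\<close>

lemma run_len_bound_two: "2 * run_len k + 3 \<le> 2 * (letter_len La k + letter_len d k)"
  by (rule run_len_le_tribonacci_like[of "\<lambda>k. 2 * (letter_len La k + letter_len d k)"];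
      (simp only: letter_len_rec)?; cases d; simp)

text \<open>Excludes runs with three times as many positions as their period.\<close>

lemma run_len_bound_three: "2 * run_len k + 3 \<le> 6 * letter_len d k"
  by (rule run_len_le_tribonacci_like[of "\<lambda>k. 6 * letter_len d k"];
      (simp only: letter_len_rec)?; cases d; simp)

lemma strict_mono_run_len: "strict_mono run_len"
proof (rule strict_mono_Suc_iff[THEN iffD2], rule allI)
  show "run_len k < run_len (Suc k)" for k
    using block_start_ge[of "run_len k"] by (simp add: run_len_Suc)
qed

section \<open>Squares and runs\<close>

definition seed :: "nat \<Rightarrow> bool" where
  "seed s \<longleftrightarrow> trib s \<noteq> trib (Suc s) \<and> (0 < s \<longrightarrow> trib (s - 1) \<noteq> trib s)"

lemma seed_iff_periodic_run: "seed s \<longleftrightarrow> periodic_run s 0 1"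
  unfolding seed_def periodic_run_def by auto

definition repeats :: "nat \<Rightarrow> nat \<Rightarrow> nat \<Rightarrow> bool" where
  "repeats i l p \<longleftrightarrow> (\<forall>j. i \<le> j \<and> j < i + l \<longrightarrow> trib j = trib (j + p))"

lemma repeatsD:
  assumes "repeats i l p" "j < l" shows "trib (i + j) = trib (i + j + p)"
proof -
  have "i \<le> i + j \<and> i + j < i + l" using assms(2) by simp
  then show ?thesis using assms(1) unfolding repeats_def by blast
qed

lemma repeatsI:
  assumes "\<And>j. j < l \<Longrightarrow> trib (i + j) = trib (i + j + p)" shows "repeats i l p"
  unfolding repeats_def
proof (intro allI impI; elim conjE)
  fix j assume "i \<le> j" "j < i + l"
  then show "trib j = trib (j + p)" using assms[of "j - i"] by simp
qed

text \<open>The extension to the right stops because the word is not eventually periodic; to the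
  left it stops at a mismatch or at position 0.\<close>

lemma repeats_extend:
  assumes "1 \<le> p" "repeats i l p"
  obtains s v where "periodic_run s v p" "s \<le> i" "i + l \<le> s + v"
proof -
  define e where "e = (LEAST e. i + l \<le> e \<and> trib e \<noteq> trib (e + p))"
  have ex: "\<exists>e. i + l \<le> e \<and> trib e \<noteq> trib (e + p)"
    using not_eventually_periodic[OF assms(1), of "i + l"] by blast
  have e: "i + l \<le> e" "trib e \<noteq> trib (e + p)"
    using LeastI_ex[OF ex] unfolding e_def by blast+
  have e_min: "trib j = trib (j + p)" if "i + l \<le> j" "j < e" for j
    using not_less_Least[of j "\<lambda>e. i + l \<le> e \<and> trib e \<noteq> trib (e + p)"] that
    unfolding e_def by blast
  define Q where "Q s \<longleftrightarrow> s \<le> i \<and> (\<forall>j. s \<le> j \<and> j < e \<longrightarrow> trib j = trib (j + p))" for s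
  have "trib j = trib (j + p)" if "i \<le> j" "j < e" for j
  proof (cases "j < i + l")
    case True
    then show ?thesis using assms(2) that(1) unfolding repeats_def by blast
  next
    case False
    then show ?thesis using that(2) by (intro e_min) simp_all
  qed
  then have "Q i" unfolding Q_def by blast
  then have s: "Q (Least Q)" by (rule LeastI)
  have s_min: "\<not> Q j" if "j < Least Q" for j using that by (rule not_less_Least)
  define s where "s = Least Q"
  have "s \<le> i" "\<And>j. s \<le> j \<Longrightarrow> j < e \<Longrightarrow> trib j = trib (j + p)"
    using s unfolding s_def Q_def by blast+
  note s' = this
  have left: "trib (s - 1) \<noteq> trib (s - 1 + p)" if "0 < s"
  proof
    assume eq: "trib (s - 1) = trib (s - 1 + p)"
    have "Q (s - 1)"
      unfolding Q_def
    proof (intro conjI allI impI; (elim conjE)?)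
      show "s - 1 \<le> i" using s'(1) by simp
      fix j assume "s - 1 \<le> j" "j < e"
      then show "trib j = trib (j + p)"
      proof (cases "j = s - 1")
        case True
        then show ?thesis using eq by (simp only:)
      next
        case False
        then have "s \<le> j" using \<open>s - 1 \<le> j\<close> that by linarith
        then show ?thesis using \<open>j < e\<close> by (rule s'(2))
      qed
    qed
    then show False using s_min[of "s - 1"] that unfolding s_def by simp
  qed
  have "s + (e - s) = e" using s'(1) e(1) by simp
  then have "periodic_run s (e - s) p"
    unfolding periodic_run_def using assms(1) s'(2) e(2) left by (simp only:) blast
  moreover have "i + l \<le> s + (e - s)" using e(1) by simp
  ultimately show thesis using that s'(1) by blast
qed

lemma repeats_level:
  assumes "1 \<le> p" "repeats i l p" "p \<le> l"
  obtains k s where "seed s" "p = letter_len (trib s) k"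
    "iter_start k s \<le> i" "i + l \<le> iter_start k s + run_len k"
proof -
  obtain s' v where run: "periodic_run s' v p" "s' \<le> i" "i + l \<le> s' + v"
    using repeats_extend[OF assms(1,2)] by blast
  obtain k s p0 where *: "periodic_run s 0 p0" "s' = iter_start k s" "v = run_len k"
    "p = iter_start k (s + p0) - iter_start k s"
    using periodic_run_obtain[OF run(1)] by blast
  have "p \<le> run_len k" using run assms(3) *(3) by linarith
  \<comment> \<open>A period of at least two letters would have an image of length at least that of
    two adjacent letters, which exceeds the run and hence the bound \<open>p\<close>.\<close>
  have "p0 = 1"
  proof (rule ccontr)
    assume "p0 \<noteq> 1"
    moreover have "1 \<le> p0" using *(1) unfolding periodic_run_def by blast
    ultimately have "Suc (Suc s) \<le> s + p0" by simp
    then have "iter_start k (Suc (Suc s)) \<le> iter_start k (s + p0)"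
      using strict_mono_iter_start[of k] by (simp only: strict_mono_less_eq)
    then have "letter_len (trib s) k + letter_len (trib (Suc s)) k \<le> run_len k"
      using \<open>p \<le> run_len k\<close> *(4) unfolding iter_start_Suc by linarith
    moreover have "trib s = La \<or> trib (Suc s) = La" using trib_La_after by blast
    ultimately show False
      using run_len_bound_two[of k "trib s"] run_len_bound_two[of k "trib (Suc s)"] by auto
  qed
  then have "seed s" "p = letter_len (trib s) k"
    using * by (simp_all add: seed_iff_periodic_run iter_start_Suc)
  then show thesis using that run * by blast
qed

lemma level_run:
  assumes "seed s"
  shows "periodic_run (iter_start k s) (run_len k) (letter_len (trib s) k)"
  using periodic_run_iter[of s 1 k] assms by (simp add: seed_iff_periodic_run iter_start_Suc)

lemma level_repeats:
  assumes "seed s" "iter_start k s \<le> i" "i + l \<le> iter_start k s + run_len k"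
  shows "repeats i l (letter_len (trib s) k)"
proof -
  have eq: "trib j = trib (j + letter_len (trib s) k)"
    if "iter_start k s \<le> j" "j < iter_start k s + run_len k" for j
    using level_run[OF assms(1), of k] that unfolding periodic_run_def by blast
  show ?thesis
  proof (rule repeatsI)
    fix j assume "j < l"
    then show "trib (i + j) = trib (i + j + letter_len (trib s) k)"
      using assms(2,3) by (intro eq) linarith+
  qed
qed

text \<open>If the ends differed, a boundary mismatch of one run would lie inside the other.\<close>

lemma periodic_run_unique:
  assumes "periodic_run s v p" "periodic_run s' v' p"
    and "s \<le> i" "i < s + v" "s' \<le> i" "i < s' + v'"
  shows "s = s' \<and> v = v'"
proof -
  have half: "\<not> s < s' \<and> \<not> s + v < s' + v'"
    if "periodic_run s v p" "periodic_run s' v' p" "s \<le> i" "i < s + v" "s' \<le> i" "i < s' + v'"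
    for s v s' v'
  proof (intro conjI notI)
    assume "s < s'"
    then have pos: "0 < s'" and bounds: "s \<le> s' - 1" "s' - 1 < s + v" using that by linarith+
    have "trib (s' - 1) \<noteq> trib (s' - 1 + p)"
      using that(2) pos unfolding periodic_run_def by blast
    then show False using that(1) bounds unfolding periodic_run_def by blast
  next
    assume less: "s + v < s' + v'"
    have bound: "s' \<le> s + v" using that by linarith
    have "trib (s + v) \<noteq> trib (s + v + p)" using that(1) unfolding periodic_run_def by blast
    then show False using that(2) less bound unfolding periodic_run_def by blast
  qed
  have "s = s'" using half[OF assms] half[OF assms(2,1,5,6,3,4)] by linarith
  moreover have "s + v = s' + v'" using half[OF assms] half[OF assms(2,1,5,6,3,4)] by linarith
  ultimately show ?thesis by simp
qed

section \<open>Squares as pairs of a starting position and a period\<close>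

definition square_start :: "nat \<Rightarrow> nat \<Rightarrow> bool" where
  "square_start i q \<longleftrightarrow> 1 \<le> q \<and> repeats i q q"

text \<open>An occurrence of the root at distance \<open>r\<close> inside the square would produce a run of period
  \<open>min r (q - r)\<close> with at least three times as many positions as its period.\<close>

lemma no_inner_occurrence:
  assumes "square_start i q" "0 < r" "r < q"
  shows "\<exists>j<q. trib (i + r + j) \<noteq> trib (i + j)"
proof (rule ccontr)
  assume "\<not> ?thesis"
  then have occ: "trib (i + r + j) = trib (i + j)" if "j < q" for j using that by blast
  have sq: "trib (i + j) = trib (i + j + q)" if "j < q" for j
    using assms(1) that unfolding square_start_def by (blast intro: repeatsD)
  \<comment> \<open>From \<open>2 * r \<le> q\<close> follows
    \<open>3 * r \<le> 2 * q - r\<close>.\<close>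
  have no: False if r: "0 < r" "2 * r \<le> q" and rep: "repeats i (2 * q - r) r" for r
  proof -
    obtain k s where *: "r = letter_len (trib s) k"
      "iter_start k s \<le> i" "i + (2 * q - r) \<le> iter_start k s + run_len k"
      by (rule repeats_level[OF _ rep]) (use r in auto)
    then have "3 * letter_len (trib s) k \<le> run_len k" using r by linarith
    then show False using run_len_bound_three[of k "trib s"] by linarith
  qed
  have "repeats i (2 * q - r) r"
  proof (rule repeatsI)
    fix h assume h: "h < 2 * q - r"
    show "trib (i + h) = trib (i + h + r)"
    proof (cases "h < q")
      case True
      have "i + h + r = i + r + h" by simp
      then show ?thesis using occ[OF True] by metis
    next
      case False
      define g where "g = h - q"
      have g: "h = g + q" "g + r < q" "g < q" using False h assms unfolding g_def by auto
      have "i + h = i + g + q" "i + h + r = i + (g + r) + q" "i + (g + r) = i + r + g"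
        using g by simp_all
      then show ?thesis using sq[OF g(2)] sq[OF g(3)] occ[OF g(3)] by metis
    qed
  qed
  \<comment> \<open>Here the occurrence at \<open>i + r\<close> is compared with the second half of
    the square at \<open>i + q\<close>, at distance \<open>q - r\<close>.\<close>
  moreover have "repeats i (2 * q - (q - r)) (q - r)"
  proof (rule repeatsI)
    fix h assume h: "h < 2 * q - (q - r)"
    show "trib (i + h) = trib (i + h + (q - r))"
    proof (cases "h < r")
      case False
      define g where "g = h - r"
      have g: "h = r + g" "g < q" using False h assms unfolding g_def by auto
      have "i + h = i + r + g" "i + h + (q - r) = i + g + q" using g assms by simp_all
      then show ?thesis using occ[OF g(2)] sq[OF g(2)] by metis
    next
      case True
      define g where "g = h + (q - r)"
      have g: "g < q" "g + r = h + q" using True assms unfolding g_def by auto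
      have "i + h + q = i + r + g" "i + h + (q - r) = i + g" using g unfolding g_def by simp_all
      moreover have "h < q" using True assms by simp
      ultimately show ?thesis using occ[OF g(1)] sq[of h] by metis
    qed
  qed
  moreover have "2 * r \<le> q \<or> 2 * (q - r) \<le> q" by linarith
  moreover have "0 < q - r" using assms by simp
  ultimately show False using no assms(2) by blast
qed

lemma occurs_at_iff:
  "occurs_at w (Suc i) \<longleftrightarrow> (\<forall>j<length w. trib (i + j) = w ! j)"
  unfolding occurs_at_def trib_def
  by (auto simp: list_eq_iff_nth_eq sdrop_snth)

lemma nth_occurrence_unique:
  assumes "nth_occurrence w p i" "nth_occurrence w p i'"
  shows "i = i'"
proof -
  have "\<not> i < i'" if "nth_occurrence w p i" "nth_occurrence w p i'" for i i'
  proof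
    assume "i < i'"
    then have "i' \<notin> {j. j \<le> i \<and> occurs_at w j}" "i' \<in> {j. j \<le> i' \<and> occurs_at w j}"
      using that(2) unfolding nth_occurrence_def by auto
    moreover have "{j. j \<le> i \<and> occurs_at w j} \<subseteq> {j. j \<le> i' \<and> occurs_at w j}"
      using \<open>i < i'\<close> by auto
    ultimately have "{j. j \<le> i \<and> occurs_at w j} \<subset> {j. j \<le> i' \<and> occurs_at w j}"
      by blast
    then have "card {j. j \<le> i \<and> occurs_at w j} < card {j. j \<le> i' \<and> occurs_at w j}"
      by (intro psubset_card_mono) auto
    then show False using that unfolding nth_occurrence_def by simp
  qed
  from this[OF assms] this[OF assms(2,1)] show ?thesis by simp
qed

text \<open>Consecutive numbering demands that no occurrence of \<open>w\<close> start strictly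
  between the two halves. That is \<open>no_inner_occurrence\<close>, so every repetition
  \<open>ww\<close> is counted.\<close>

lemma square_at_iff:
  assumes "w \<noteq> []"
  shows "square_at w p (Suc i) \<longleftrightarrow>
    nth_occurrence w p (Suc i) \<and> square_start i (length w)"
proof
  assume sq: "square_at w p (Suc i)"
  then have "occurs_at w (Suc i)" "occurs_at w (Suc (i + length w))"
    unfolding square_at_def nth_occurrence_def by simp_all
  then have "trib (i + j) = w ! j" "trib (i + length w + j) = w ! j" if "j < length w" for j
    using that unfolding occurs_at_iff by simp_all
  then have "trib (i + j) = trib (i + j + length w)" if "j < length w" for j
    using that by (metis add.assoc add.commute)
  then have "repeats i (length w) (length w)" by (rule repeatsI)
  then show "nth_occurrence w p (Suc i) \<and> square_start i (length w)"
    using sq assms unfolding square_at_def square_start_def by (simp add: Suc_le_eq)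
next
  assume "nth_occurrence w p (Suc i) \<and> square_start i (length w)"
  then have nth: "nth_occurrence w p (Suc i)" and sq: "square_start i (length w)" by auto
  have occ: "occurs_at w (Suc i)" and p: "card {j. j \<le> Suc i \<and> occurs_at w j} = p"
    using nth unfolding nth_occurrence_def by auto
  have occ': "occurs_at w (Suc (i + length w))"
    unfolding occurs_at_iff
  proof (intro allI impI)
    fix j assume j: "j < length w"
    then have "trib (i + j) = trib (i + j + length w)"
      using sq unfolding square_start_def by (blast intro: repeatsD)
    then show "trib (i + length w + j) = w ! j"
      using occ j unfolding occurs_at_iff by (simp add: ac_simps)
  qed
  have inner: "\<not> occurs_at w j" if "Suc i < j" "j < Suc (i + length w)" for j
  proof
    assume "occurs_at w j"
    define r where "r = j - Suc i"
    have r: "j = Suc (i + r)" "0 < r" "r < length w" using that unfolding r_def by auto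
    from no_inner_occurrence[OF sq r(2,3)] obtain h where
      "h < length w" "trib (i + r + h) \<noteq> trib (i + h)" by blast
    moreover have "trib (i + r + h) = w ! h" "trib (i + h) = w ! h"
      using \<open>occurs_at w j\<close> occ \<open>h < length w\<close> unfolding r(1) occurs_at_iff by simp_all
    ultimately show False by simp
  qed
  have "{j. j \<le> Suc (i + length w) \<and> occurs_at w j} =
      insert (Suc (i + length w)) {j. j \<le> Suc i \<and> occurs_at w j}"
  proof (intro equalityI subsetI)
    fix j assume "j \<in> {j. j \<le> Suc (i + length w) \<and> occurs_at w j}"
    then show "j \<in> insert (Suc (i + length w)) {j. j \<le> Suc i \<and> occurs_at w j}"
      using inner[of j] by fastforce
  next
    fix j assume "j \<in> insert (Suc (i + length w)) {j. j \<le> Suc i \<and> occurs_at w j}"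
    then show "j \<in> {j. j \<le> Suc (i + length w) \<and> occurs_at w j}"
      using occ' by auto
  qed
  then have "card {j. j \<le> Suc (i + length w) \<and> occurs_at w j} = p + 1"
    using p assms by (simp add: card_insert_if)
  then show "square_at w p (Suc i)"
    using nth occ' unfolding square_at_def nth_occurrence_def by simp
qed

text \<open>A word and the index of its occurrence determine the starting position, and conversely.
  With \<open>i\<close> counted from 0, the last position of the square, counted from 1, is
  \<open>i + 2 * q\<close>.\<close>

lemma num_squares_eq:
  "num_squares n = card {(i, q). square_start i q \<and> i + 2 * q \<le> n}"
proof -
  define f where "f = (\<lambda>(i, q). let w = map trib [i..<i + q] in
    (w, card {j. j \<le> Suc i \<and> occurs_at w j}))"
  let ?S = "{(i, q). square_start i q \<and> i + 2 * q \<le> n}"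
  have occ: "occurs_at (map trib [i..<i + q]) (Suc i)" for i q
    by (simp add: occurs_at_iff)
  have nth: "nth_occurrence (fst (f (i, q))) (snd (f (i, q))) (Suc i)" for i q
    using occ by (simp add: f_def Let_def nth_occurrence_def)
  have len: "length (fst (f (i, q))) = q" for i q
    by (simp add: f_def Let_def)
  have "bij_betw f ?S (squares_in_prefix n)"
    unfolding bij_betw_def
  proof
    show "inj_on f ?S"
    proof (rule inj_onI)
      fix x y assume "f x = f y"
      moreover obtain i q i' q' where "x = (i, q)" "y = (i', q')" by fastforce
      ultimately show "x = y"
        using len nth nth_occurrence_unique by (metis Suc_inject)
    qed
    show "f ` ?S = squares_in_prefix n"
    proof (intro equalityI subsetI)
      fix z assume "z \<in> f ` ?S"
      then obtain i q where *: "square_start i q" "i + 2 * q \<le> n" "z = f (i, q)" by auto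
      define w where "w = fst (f (i, q))"
      have w: "length w = q" "w \<noteq> []"
        using len[of i q] *(1) unfolding w_def square_start_def by auto
      have "square_at w (snd (f (i, q))) (Suc i)"
        using square_at_iff[OF w(2)] nth[of i q] *(1) w(1) unfolding w_def by simp
      moreover have "Suc i + 2 * length w - 1 \<le> n" using *(2) w(1) by simp
      moreover have "z = (w, snd (f (i, q)))" using *(3) unfolding w_def by simp
      ultimately show "z \<in> squares_in_prefix n"
        unfolding squares_in_prefix_def using w(2) by blast
    next
      fix z assume "z \<in> squares_in_prefix n"
      then obtain w p i' where *: "z = (w, p)" "w \<noteq> []" "square_at w p i'"
        "i' + 2 * length w - 1 \<le> n"
        unfolding squares_in_prefix_def by blast
      have "1 \<le> i'"
        using *(3) unfolding square_at_def nth_occurrence_def occurs_at_def by blast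
      then obtain i where i: "i' = Suc i" by (cases i') auto
      have sq: "nth_occurrence w p (Suc i)" "square_start i (length w)"
        using *(3) square_at_iff[OF *(2)] i by auto
      have "w = map trib [i..<i + length w]"
        using sq(1) unfolding nth_occurrence_def occurs_at_iff
        by (intro nth_equalityI) auto
      then have "z = f (i, length w)"
        using sq(1) *(1) unfolding f_def nth_occurrence_def by (simp add: Let_def)
      moreover have "(i, length w) \<in> ?S" using sq(2) *(4) i by auto
      ultimately show "z \<in> f ` ?S" by blast
    qed
  qed
  then show ?thesis unfolding num_squares_def by (simp add: bij_betw_same_card)
qed

section \<open>Counting the squares of each level\<close>

lemma iter_start_less_iff [simp]: "iter_start k a < iter_start k b \<longleftrightarrow> a < b"
  by (rule strict_mono_less[OF strict_mono_iter_start])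

lemma iter_start_le_iff [simp]: "iter_start k a \<le> iter_start k b \<longleftrightarrow> a \<le> b"
  by (rule strict_mono_less_eq[OF strict_mono_iter_start])

lemma iter_start_trib_num: "iter_start k (trib_num j) = trib_num (j + k)"
  by (simp only: iter_start_1[symmetric] add.commute[of j] funpow_add comp_apply)

lemma trib_num_mono: "m \<le> n \<Longrightarrow> trib_num m \<le> trib_num n"
proof -
  have "trib_num k \<le> trib_num (Suc k)" for k
    by (simp add: trib_num_eq)
  then show "m \<le> n \<Longrightarrow> ?thesis" by (rule lift_Suc_mono_le)
qed

text \<open>Bounds the levels: a square whose level exceeds \<open>m\<close> is longer than the
  prefix of length \<open>trib_num m\<close>.\<close>

lemma trib_num_le_double_letter_len: "trib_num k < 2 * letter_len d (Suc k)"
proof -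
  have "letter_len La k < 2 * letter_len d (Suc k)"
    using letter_len_pos[of La k] by (cases d) simp_all
  then show ?thesis by (simp add: trib_num_eq)
qed

definition level_squares :: "nat \<Rightarrow> nat \<Rightarrow> nat \<Rightarrow> nat set" where
  "level_squares n k s = {i. iter_start k s \<le> i \<and>
     i + letter_len (trib s) k \<le> iter_start k s + run_len k \<and> i + 2 * letter_len (trib s) k \<le> n}"

text \<open>With \<open>q\<close> the period, the condition \<open>i + 2 * q \<le> n\<close> says
  that the first half ends at most \<open>n - iter_start k (Suc s)\<close> positions after the start
  of the run, since \<open>iter_start k (Suc s)\<close> is that start plus \<open>q\<close>. The
  prefix thus acts by truncating the run.\<close>

lemma card_level_squares:
  assumes "iter_start k (Suc s) \<le> n"
  shows "card (level_squares n k s) =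
    Suc (min (run_len k) (n - iter_start k (Suc s))) - letter_len (trib s) k"
proof -
  define S q R where "S = iter_start k s" and "q = letter_len (trib s) k" and "R = run_len k"
  have le: "S + q \<le> n" using assms by (simp add: iter_start_Suc S_def q_def)
  have "level_squares n k s = {S..<Suc (S + min R (n - (S + q))) - q}"
    using le unfolding level_squares_def S_def[symmetric] q_def[symmetric] R_def[symmetric] by auto
  then have "card (level_squares n k s) = Suc (min R (n - (S + q))) - q" by simp
  then show ?thesis by (simp add: iter_start_Suc S_def q_def R_def)
qed

lemma square_start_level:
  assumes "square_start i q" "i + 2 * q \<le> trib_num m"
  obtains k s where "k < m" "s < trib_num (m - k)" "seed s" "q = letter_len (trib s) k"
    "i \<in> level_squares (trib_num m) k s"
proof -
  obtain k s where *: "seed s" "q = letter_len (trib s) k"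
    "iter_start k s \<le> i" "i + q \<le> iter_start k s + run_len k"
    using assms(1) unfolding square_start_def by (metis repeats_level order_refl)
  have q: "0 < q" using * by simp
  have "k \<le> m"
  proof (rule ccontr)
    assume "\<not> k \<le> m"
    then obtain k' where k': "k = Suc k'" "m \<le> k'" by (cases k) auto
    then have "trib_num m < 2 * q"
      using trib_num_mono[OF k'(2)] trib_num_le_double_letter_len[of k' "trib s"] *(2) by simp
    then show False using assms(2) by simp
  qed
  have "iter_start k s < trib_num m" using *(3) assms(2) q by linarith
  also have "trib_num m = iter_start k (trib_num (m - k))"
    using \<open>k \<le> m\<close> by (simp add: iter_start_trib_num)
  finally have s: "s < trib_num (m - k)" by simp
  \<comment> \<open>At level \<open>m\<close> only the first letter is available, and its image
    already fills the prefix.\<close>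
  have "k \<noteq> m"
  proof
    assume "k = m"
    then have "s = 0" using s by (simp add: trib_num_def)
    then have "q = trib_num m" using *(2) \<open>k = m\<close> by (simp add: trib_num_eq)
    then show False using assms(2) q by simp
  qed
  then show thesis using that[of k s] * s assms(2) \<open>k \<le> m\<close> unfolding level_squares_def by simp
qed

text \<open>Both runs have the same period and contain \<open>i\<close>, so they coincide. Their
  common length determines the level, and the starting position then determines the letter.\<close>

lemma square_start_level_unique:
  assumes "seed s" "seed s'" "letter_len (trib s) k = letter_len (trib s') k'"
    and "i \<in> level_squares n k s" "i \<in> level_squares n k' s'"
  shows "k = k' \<and> s = s'"
proof -
  define p where "p = letter_len (trib s) k"
  have "0 < p" unfolding p_def by simp
  have "iter_start k s = iter_start k' s' \<and> run_len k = run_len k'"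
  proof (rule periodic_run_unique)
    show "periodic_run (iter_start k s) (run_len k) p"
      "periodic_run (iter_start k' s') (run_len k') p"
      using level_run[OF assms(1), of k] level_run[OF assms(2), of k'] assms(3)
      unfolding p_def by simp_all
    have "iter_start k s \<le> i" "iter_start k' s' \<le> i"
      "i + p \<le> iter_start k s + run_len k" "i + p \<le> iter_start k' s' + run_len k'"
      using assms(3-5) unfolding level_squares_def p_def by simp_all
    then show "iter_start k s \<le> i" "iter_start k' s' \<le> i"
      "i < iter_start k s + run_len k" "i < iter_start k' s' + run_len k'"
      using \<open>0 < p\<close> by linarith+
  qed
  then have "k = k'" by (simp add: strict_mono_eq[OF strict_mono_run_len])
  moreover have "s = s'"
    using \<open>_ \<and> _\<close> \<open>k = k'\<close> strict_mono_iter_start[of k] by (simp add: strict_mono_eq)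
  ultimately show ?thesis by simp
qed

lemma finite_level_squares [simp]: "finite (level_squares n k s)"
  by (rule finite_subset[of _ "{..n}"]) (auto simp: level_squares_def)

lemma num_squares_trib_num:
  "num_squares (trib_num m) =
    (\<Sum>k<m. \<Sum>s | s < trib_num (m - k) \<and> seed s. card (level_squares (trib_num m) k s))"
proof -
  let ?n = "trib_num m"
  define D where "D = (SIGMA k:{..<m}. SIGMA s:{s. s < trib_num (m - k) \<and> seed s}. level_squares ?n k s)"
  define f where "f = (\<lambda>(k, s, i). (i :: nat, letter_len (trib s) k))"
  have "inj_on f D"
  proof (rule inj_onI)
    fix x y assume xy: "x \<in> D" "y \<in> D" "f x = f y"
    obtain k s i k' s' i' where eq: "x = (k, s, i)" "y = (k', s', i')" by (metis prod_cases3)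
    have "k = k' \<and> s = s'"
      by (rule square_start_level_unique[of s s' k k' i ?n])
        (use xy in \<open>auto simp: eq D_def f_def\<close>)
    then show "x = y" using xy(3) by (simp add: eq f_def)
  qed
  moreover have "f ` D = {(i, q). square_start i q \<and> i + 2 * q \<le> ?n}"
  proof (intro equalityI subsetI)
    fix z assume "z \<in> f ` D"
    then obtain k s i where *: "seed s" "i \<in> level_squares ?n k s" "z = (i, letter_len (trib s) k)"
      by (auto simp: D_def f_def)
    then have "repeats i (letter_len (trib s) k) (letter_len (trib s) k)"
      by (intro level_repeats) (auto simp: level_squares_def)
    then show "z \<in> {(i, q). square_start i q \<and> i + 2 * q \<le> ?n}"
      using * letter_len_pos[of "trib s" k]
      by (auto simp: square_start_def level_squares_def Suc_le_eq simp del: letter_len_pos)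
  next
    fix z assume "z \<in> {(i, q). square_start i q \<and> i + 2 * q \<le> ?n}"
    then obtain i q where z: "z = (i, q)" "square_start i q" "i + 2 * q \<le> ?n" by auto
    obtain k s where "k < m" "s < trib_num (m - k)" "seed s" "q = letter_len (trib s) k"
      "i \<in> level_squares ?n k s"
      using square_start_level[OF z(2,3)] by blast
    then show "z \<in> f ` D" unfolding z(1) D_def f_def by (intro image_eqI[of _ _ "(k, s, i)"]) auto
  qed
  ultimately have "num_squares ?n = card D"
    unfolding num_squares_eq by (metis card_image)
  also have "\<dots> = (\<Sum>k<m. \<Sum>s | s < trib_num (m - k) \<and> seed s. card (level_squares ?n k s))"
    unfolding D_def by (subst card_SigmaI; simp)+
  finally show ?thesis .
qed

text \<open>The Tribonacci numbers shifted by three: \<open>trib_seq (m + 3)\<close> is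
  \<open>trib_num m\<close>. The shift supplies the values at negative indices that occur in letter
  counts of short prefixes, and integer values permit subtraction.\<close>

fun trib_seq :: "nat \<Rightarrow> int" where
  "trib_seq 0 = 0"
| "trib_seq (Suc 0) = 0"
| "trib_seq (Suc (Suc 0)) = 1"
| "trib_seq (Suc (Suc (Suc n))) = trib_seq (Suc (Suc n)) + trib_seq (Suc n) + trib_seq n"

lemma trib_seq_numeral [simp]:
  "trib_seq 2 = 1" "trib_seq 3 = 1" "trib_seq 4 = 2" "trib_seq 5 = 4" "trib_seq 6 = 7"
  "trib_seq 7 = 13" "trib_seq 8 = 24"
  by (simp_all add: numeral_eq_Suc)

lemma letter_len_trib_seq:
  "int (letter_len La k) = trib_seq (k + 3)"
  "int (letter_len Lb k) = trib_seq (k + 2) + trib_seq (k + 1)"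
  "int (letter_len Lc k) = trib_seq (k + 2)"
proof -
  have "int (letter_len La k) = trib_seq (k + 3) \<and>
    int (letter_len Lb k) = trib_seq (k + 2) + trib_seq (k + 1) \<and>
    int (letter_len Lc k) = trib_seq (k + 2)"
    by (induction k) (simp_all add: numeral_eq_Suc)
  then show "int (letter_len La k) = trib_seq (k + 3)"
    "int (letter_len Lb k) = trib_seq (k + 2) + trib_seq (k + 1)"
    "int (letter_len Lc k) = trib_seq (k + 2)" by simp_all
qed

lemma trib_num_trib_seq: "int (trib_num m) = trib_seq (m + 3)"
  by (simp add: trib_num_eq letter_len_trib_seq)

lemma trib_seq_rec: "trib_seq (n + 3) = trib_seq (n + 2) + trib_seq (n + 1) + trib_seq n"
  by (simp add: numeral_eq_Suc)

lemma run_len_trib_seq: "2 * int (run_len k) + 3 = trib_seq (k + 2) + trib_seq (k + 4)"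
proof (induction k rule: induct3)
  case (step k)
  have "int (run_len (k + 3)) = int (run_len (k + 2)) + int (run_len (k + 1)) + int (run_len k) + 3"
    by (simp add: run_len_rec)
  then show ?case
    using step trib_seq_rec[of "k + 2"] trib_seq_rec[of "k + 4"] by (simp add: ac_simps)
qed simp_all

lemma trib_num_Suc: "trib_num (Suc j) = block_start (trib_num j)"
  using iter_start_trib_num[of 1 j] by simp

lemma letter_count_trib_num:
  "int (letter_count La (trib_num j)) = trib_seq (j + 2)"
  "int (letter_count Lb (trib_num j)) = trib_seq (j + 1)"
  "int (letter_count Lc (trib_num j)) = trib_seq j"
proof -
  have "int (letter_count La (trib_num j)) = trib_seq (j + 2) \<and>
    int (letter_count Lb (trib_num j)) = trib_seq (j + 1) \<and>
    int (letter_count Lc (trib_num j)) = trib_seq j"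
  proof (induction j)
    case 0
    show ?case by (simp add: trib_num_def letter_count_Suc numeral_eq_Suc)
  next
    case (Suc j)
    then show ?case by (simp add: trib_num_Suc trib_num_trib_seq numeral_eq_Suc)
  qed
  then show "int (letter_count La (trib_num j)) = trib_seq (j + 2)"
    "int (letter_count Lb (trib_num j)) = trib_seq (j + 1)"
    "int (letter_count Lc (trib_num j)) = trib_seq j" by simp_all
qed

section \<open>Isolated letters in prefixes of Tribonacci length\<close>

lemma seed_not_La:
  assumes "trib s \<noteq> La" shows "seed s"
  using assms trib_La_after[OF assms] trib_La_before[OF assms] unfolding seed_def by simp

text \<open>Two adjacent \<open>a\<close>s arise exactly from a block \<open>sigma Lc\<close> and
  the start of the next block.\<close>

lemma seed_block_start:
  "seed (block_start n) \<longleftrightarrow> trib n \<noteq> Lc \<and> (0 < n \<longrightarrow> trib (n - 1) \<noteq> Lc)"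
proof (cases n)
  case 0
  have "trib (Suc 0) = rot La" using trib_Suc_block_start[of 0] by simp
  then show ?thesis by (simp add: 0 seed_def)
next
  case (Suc n')
  have "0 < block_start n" using Suc by (metis block_start_eq_0_iff neq0_conv nat.distinct(1))
  then show ?thesis using trib_before_block_start[of n'] Suc
    unfolding seed_def trib_Suc_block_start trib_block_start by (cases "trib n"; cases "trib n'") simp_all
qed

text \<open>All \<open>b\<close> and \<open>c\<close> are isolated. Each \<open>c\<close> among the
  first \<open>n\<close> letters spoils the \<open>a\<close> of its own block, and also the
  \<open>a\<close> of the next block if that lies within range, which is what the count up to
  \<open>n - 1\<close> records.\<close>

lemma sum_seeds_block_start:
  fixes g :: "letter \<Rightarrow> int"
  shows "(\<Sum>s<block_start n. if seed s then g (trib s) else 0) =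
    (int n - int (letter_count Lc n) - int (letter_count Lc (n - 1))) * g La
    + int (letter_count La n) * g Lb + int (letter_count Lb n) * g Lc"
proof (induction n)
  case (Suc n)
  let ?f = "\<lambda>s. if seed s then g (trib s) else 0"
  have "(\<Sum>s<block_start (Suc n). ?f s) = (\<Sum>s<block_start n. ?f s) +
      (if seed (block_start n) then g La else 0) + (if trib n = Lc then 0 else g (rot (trib n)))"
  proof (cases "trib n = Lc")
    case False
    then have "seed (Suc (block_start n))" by (intro seed_not_La) simp
    then show ?thesis using False by (simp add: block_start_Suc_cases)
  qed (simp add: block_start_Suc_cases)
  \<comment> \<open>Two letters \<open>c\<close> are never adjacent, so no \<open>a\<close> is
    subtracted twice.\<close>
  moreover have "trib n = Lc \<Longrightarrow> 0 < n \<Longrightarrow> trib (n - 1) \<noteq> Lc"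
    using trib_La_before[of n] by simp
  moreover have "seed 0" using seed_block_start[of 0] by simp
  ultimately show ?case using Suc
    by (cases n; cases "trib n") (auto simp: seed_block_start letter_count_Suc algebra_simps)
qed simp

lemma trib_num_pos: "0 < trib_num j"
  using trib_num_gt[of j] by simp

text \<open>The last letter of an image is \<open>rot\<close> of the last letter of the word, so the
  last letters cycle through \<open>a\<close>, \<open>b\<close>, \<open>c\<close>.\<close>

lemma trib_num_last:
  shows "j mod 3 = 0 \<Longrightarrow> trib (trib_num j - 1) = La"
    and "j mod 3 = 1 \<Longrightarrow> trib (trib_num j - 1) = Lb"
    and "j mod 3 = 2 \<Longrightarrow> trib (trib_num j - 1) = Lc"
proof -
  have pos: "trib_num j = Suc (trib_num j - 1)" for j using trib_num_gt[of j] by simp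
  have "trib (trib_num j - 1) = (if j mod 3 = 0 then La else if j mod 3 = 1 then Lb else Lc)"
  proof (induction j)
    case (Suc j)
    have "trib (trib_num (Suc j) - 1) = rot (trib (trib_num j - 1))"
      using trib_before_block_start[of "trib_num j - 1"] pos[of j] by (simp add: trib_num_Suc)
    moreover have "j mod 3 = 0 \<or> j mod 3 = 1 \<or> j mod 3 = 2" by linarith
    ultimately show ?case using Suc by (auto simp: mod_Suc)
  qed (simp add: trib_num_def)
  then show "j mod 3 = 0 \<Longrightarrow> trib (trib_num j - 1) = La"
    and "j mod 3 = 1 \<Longrightarrow> trib (trib_num j - 1) = Lb"
    and "j mod 3 = 2 \<Longrightarrow> trib (trib_num j - 1) = Lc" by simp_all
qed

lemma trib_num_second_last:
  assumes "1 \<le> j"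
  shows "j mod 3 \<noteq> 0 \<Longrightarrow> trib (trib_num j - 2) = La \<and> seed (trib_num j - 2)"
    and "j mod 3 = 0 \<Longrightarrow> trib (trib_num j - 2) = Lb \<and> \<not> seed (trib_num j - 1)"
proof -
  have "if j mod 3 = 0 then trib (trib_num j - 2) = Lb \<and> \<not> seed (trib_num j - 1)
    else trib (trib_num j - 2) = La \<and> seed (trib_num j - 2)"
    using assms
  proof (induction j)
    case (Suc i)
    obtain n where n: "trib_num i = Suc n" using trib_num_pos[of i] by (cases "trib_num i") auto
    have t: "trib_num (Suc i) = block_start (Suc n)" using n by (simp add: trib_num_Suc)
    have "n - 1 = trib_num i - 2" using n by simp
    show ?case
    proof (cases "i mod 3 = 2")
      case False
      then have "i mod 3 = 0 \<or> i mod 3 = 1" by linarith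
      then have "trib n \<noteq> Lc" using trib_num_last[of i] n by auto
      moreover from this have "trib_num (Suc i) - 2 = block_start n"
        unfolding t block_start_Suc_cases by simp
      moreover have "trib (n - 1) \<noteq> Lc" if "0 < n"
      proof -
        have "1 \<le> i" using that n by (cases i) (simp_all add: trib_num_def)
        then show ?thesis using Suc.IH \<open>n - 1 = _\<close> by (auto split: if_splits)
      qed
      moreover have "Suc i mod 3 \<noteq> 0" using False by (simp add: mod_Suc)
      ultimately show ?thesis by (simp add: seed_block_start)
    next
      case True
      then have c: "trib n = Lc" using trib_num_last[of i] n by simp
      then have "0 < n" by (intro trib_La_before) simp
      then obtain n' where n': "n = Suc n'" by (cases n) auto
      have "1 \<le> i" using True by (cases i) simp_all
      then have "trib n' = La" using Suc.IH True n n' by simp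
      have t': "trib_num (Suc i) = Suc (block_start n)"
        unfolding t block_start_Suc_cases using c by simp
      have "trib (trib_num (Suc i) - 2) = Lb"
        using trib_before_block_start[of n'] \<open>trib n' = La\<close> n' unfolding t' by simp
      moreover have "\<not> seed (trib_num (Suc i) - 1)" unfolding t' using c by (simp add: seed_block_start)
      moreover have "Suc i mod 3 = 0" using True by (simp add: mod_Suc)
      ultimately show ?thesis by simp
    qed
  qed simp
  then show "j mod 3 \<noteq> 0 \<Longrightarrow> trib (trib_num j - 2) = La \<and> seed (trib_num j - 2)"
    and "j mod 3 = 0 \<Longrightarrow> trib (trib_num j - 2) = Lb \<and> \<not> seed (trib_num j - 1)"
    by simp_all
qed

section \<open>Contributions of complete runs and the loss at the end of the prefix\<close>

definition full_count :: "letter \<Rightarrow> nat \<Rightarrow> int" where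
  "full_count d k = int (run_len k) + 1 - int (letter_len d k)"

text \<open>A run exceeds the image of an \<open>a\<close> by exactly a run three levels lower; this
  evaluates \<open>full_count La\<close> and the truncated contribution of the final
  \<open>ba\<close>.\<close>

lemma run_len_step: "run_len (k + 3) = letter_len La (k + 3) + run_len k"
proof -
  have "2 * int (run_len (k + 3)) = 2 * int (letter_len La (k + 3)) + 2 * int (run_len k)"
    using run_len_trib_seq[of k] run_len_trib_seq[of "k + 3"] letter_len_trib_seq(1)[of "k + 3"]
      trib_seq_rec[of "k + 2"] trib_seq_rec[of "k + 3"] trib_seq_rec[of "k + 4"] trib_seq_rec[of "k + 1"]
      trib_seq_rec[of k]
    by (simp add: ac_simps)
  then show ?thesis by linarith
qed

text \<open>The third image of \<open>a\<close> is the third image of \<open>b\<close> followed by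
  \<open>a\<close>.\<close>

lemma letter_len_La_step: "letter_len La (k + 3) = letter_len Lb (k + 3) + letter_len La k"
  by (simp add: numeral_eq_Suc)

lemma letter_len_order: "letter_len Lc k \<le> letter_len Lb k" "letter_len Lb k \<le> letter_len La k"
proof -
  have "letter_len Lc k \<le> letter_len Lb k \<and> letter_len Lb k \<le> letter_len La k"
    by (induction k) auto
  then show "letter_len Lc k \<le> letter_len Lb k" "letter_len Lb k \<le> letter_len La k" by auto
qed

lemma small_or_step:
  fixes k :: nat obtains "k = 0" | "k = 1" | "k = 2" | h where "k = h + 3"
proof -
  have "k = 0 \<or> k = 1 \<or> k = 2 \<or> k = (k - 3) + 3" by linarith
  then show thesis using that by blast
qed

lemma full_count_La: "full_count La k = (if k < 3 then 0 else int (run_len (k - 3)) + 1)"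
  by (cases k rule: small_or_step) (simp_all add: full_count_def run_len_step)

lemma letter_len_le_run_len: "letter_len d k \<le> Suc (run_len k)"
proof -
  have "letter_len La k \<le> Suc (run_len k)"
    using full_count_La[of k] unfolding full_count_def by (simp split: if_splits)
  then show ?thesis using letter_len_order[of k] by (cases d) auto
qed

text \<open>What the last two letters of the prefix of length \<open>t j\<close> fail to contribute; the prefix ends
  in \<open>ba\<close>, \<open>ab\<close> or \<open>ac\<close> according to \<open>j mod 3\<close>.  For \<open>ba\<close> the value is net of one isolated
  \<open>a\<close> that \<open>full_sum\<close> omits: it subtracts two letters for each pair \<open>aa\<close>, also for the pair that
  the end of the prefix cuts in half.\<close>

definition defect :: "nat \<Rightarrow> nat \<Rightarrow> int" where
  "defect j k =
    (if j mod 3 = 0 then (if k < 3 then 0 else - 1)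
     else if j mod 3 = 1 then full_count La k + full_count Lb k
     else full_count La k + full_count Lc k)"

text \<open>The level-\<open>k\<close> count if no run were truncated. For positive
  \<open>j\<close>, the coefficients are the numbers of isolated letters in the prefix of length
  \<open>trib_num j\<close>; the number \<open>trib_seq (j - 1)\<close> of pairs \<open>aa\<close>
  is the number of \<open>c\<close> in the prefix of length \<open>trib_num (j - 1)\<close>.\<close>

definition full_sum :: "nat \<Rightarrow> nat \<Rightarrow> int" where
  "full_sum j k = (trib_seq (j + 2) - 2 * trib_seq (j - 1)) * full_count La k
     + trib_seq (j + 1) * full_count Lb k + trib_seq j * full_count Lc k"

text \<open>One of the two letters after \<open>s\<close> is \<open>a\<close>, so by
  \<open>run_len_bound_two\<close> their images leave room for the whole run.\<close>

lemma card_level_squares_full: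
  assumes "s + 3 \<le> N"
  shows "int (card (level_squares (iter_start k N) k s)) = full_count (trib s) k"
proof -
  have "iter_start k (Suc (Suc (Suc s))) \<le> iter_start k N" using assms by simp
  then have "letter_len (trib (Suc s)) k + letter_len (trib (Suc (Suc s))) k
      \<le> iter_start k N - iter_start k (Suc s)"
    unfolding iter_start_Suc[of k "Suc (Suc s)"] iter_start_Suc[of k "Suc s"] by linarith
  moreover have "trib (Suc s) = La \<or> trib (Suc (Suc s)) = La" using trib_La_after by blast
  ultimately have "run_len k \<le> iter_start k N - iter_start k (Suc s)"
    using run_len_bound_two[of k "trib (Suc s)"] run_len_bound_two[of k "trib (Suc (Suc s))"]
    by auto
  moreover have "iter_start k (Suc s) \<le> iter_start k N" using assms by simp
  ultimately show ?thesis
    using letter_len_le_run_len[of "trib s" k]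
    by (simp add: card_level_squares full_count_def of_nat_diff)
qed

lemma level_sum:
  assumes "1 \<le> j"
  shows "int (\<Sum>s | s < trib_num j \<and> seed s. card (level_squares (trib_num (j + k)) k s))
    = full_sum j k - defect j k"
proof -
  define n where "n = trib_num (j + k)"
  define c where "c s = (if seed s then int (card (level_squares n k s)) else 0)" for s
  define h where "h s = (if seed s then full_count (trib s) k else 0)" for s
  have "trib_num j = Suc (Suc (trib_num j - 2))" using trib_num_gt[of j] assms by simp
  then obtain M where M: "trib_num j = Suc (Suc M)" by blast
  have n: "n = iter_start k (Suc (Suc M))" using M iter_start_trib_num[of k j] by (simp add: n_def)
  have "int (\<Sum>s | s < trib_num j \<and> seed s. card (level_squares n k s)) = (\<Sum>s<trib_num j. c s)"
  proof -
    have "(\<Sum>s<trib_num j. c s) = (\<Sum>s\<in>{s\<in>{..<trib_num j}. seed s}. int (card (level_squares n k s)))"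
      unfolding c_def by (rule sum.inter_filter[symmetric]) simp
    then show ?thesis by simp
  qed
  also have "\<dots> = (\<Sum>s<M. c s) + c M + c (Suc M)" by (simp add: M)
  also have "(\<Sum>s<M. c s) = (\<Sum>s<M. h s)"
    by (rule sum.cong) (auto simp: c_def h_def n card_level_squares_full simp del: funpow.simps)
  \<comment> \<open>No room remains after the image of the last letter.\<close>
  also have "c (Suc M) = 0"
    using letter_len_pos[of "trib (Suc M)" k]
    by (auto simp: c_def n card_level_squares Suc_le_eq simp del: letter_len_pos)
  also have "(\<Sum>s<M. h s) + c M + 0 = (\<Sum>s<trib_num j. h s) - (h M - c M) - h (Suc M)"
    by (simp add: M)
  \<comment> \<open>If the preimage of the prefix ends in \<open>c\<close>, the partner of the final
    \<open>a\<close> lies outside the prefix, so \<open>full_sum\<close> subtracts one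
    \<open>a\<close> too many.\<close>
  also have "(\<Sum>s<trib_num j. h s) = full_sum j k
      + (if j mod 3 = 0 then full_count La k else 0)"
  proof -
    obtain i where i: "j = Suc i" using assms by (cases j) auto
    have "letter_count Lc (trib_num i) = letter_count Lc (trib_num i - 1)
      + (if trib (trib_num i - 1) = Lc then 1 else 0)"
      using letter_count_Suc[of Lc "trib_num i - 1"] Suc_pred[OF trib_num_pos[of i]]
      by (simp only: One_nat_def)
    moreover have "trib (trib_num i - 1) = Lc \<longleftrightarrow> j mod 3 = 0"
    proof -
      have "i mod 3 = 0 \<or> i mod 3 = 1 \<or> i mod 3 = 2" by linarith
      then show ?thesis using trib_num_last[of i] by (auto simp: i mod_Suc)
    qed
    ultimately have pred: "int (letter_count Lc (trib_num i - 1))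
        = trib_seq i - (if j mod 3 = 0 then 1 else 0)"
      using letter_count_trib_num(3)[of i] by (simp split: if_splits)
    have index: "trib_seq (j + 2) = trib_seq (i + 3)" "trib_seq (j - 1) = trib_seq i"
      "trib_seq (j + 1) = trib_seq (i + 2)" "trib_seq j = trib_seq (i + 1)"
      by (simp_all only: i add_Suc add_Suc_right numeral_3_eq_3 numeral_2_eq_2 diff_Suc_Suc diff_zero One_nat_def add_0_right)
    have "(\<Sum>s<trib_num j. h s) = (\<Sum>s<block_start (trib_num i).
        if seed s then full_count (trib s) k else 0)"
      unfolding h_def i trib_num_Suc ..
    also have "\<dots> = (trib_seq (i + 3) - trib_seq i - int (letter_count Lc (trib_num i - 1))) * full_count La k
        + trib_seq (i + 2) * full_count Lb k + trib_seq (i + 1) * full_count Lc k"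
      using sum_seeds_block_start[of "\<lambda>d. full_count d k" "trib_num i"]
      unfolding letter_count_trib_num trib_num_trib_seq .
    finally show ?thesis
      unfolding full_sum_def index pred by (simp only: split: if_splits) (auto simp only: algebra_simps)
  qed
  also have "full_sum j k + (if j mod 3 = 0 then full_count La k else 0) - (h M - c M) - h (Suc M)
      = full_sum j k - defect j k"
  proof -
    have card: "card (level_squares n k M)
        = Suc (min (run_len k) (letter_len (trib (Suc M)) k)) - letter_len (trib M) k"
      unfolding n by (subst card_level_squares) (simp_all add: iter_start_Suc[of k "Suc M"])
    have last: "trib_num j - 1 = Suc M" "trib_num j - 2 = M" using M by simp_all
    \<comment> \<open>For an \<open>a\<close> before a final \<open>b\<close> or \<open>c\<close>,
      the room left is less than the image of \<open>a\<close>, so no square fits.\<close>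
    have blocked: "c M = 0" if "trib M = La" "trib (Suc M) = Lb \<or> trib (Suc M) = Lc"
    proof -
      have "Suc (min (run_len k) (letter_len (trib (Suc M)) k)) \<le> letter_len La k"
      proof (cases "k < 3")
        case True
        then show ?thesis using full_count_La[of k] unfolding full_count_def by simp
      next
        case False
        then have "letter_len La k = letter_len Lb k + letter_len La (k - 3)"
          using letter_len_La_step[of "k - 3"] by simp
        then have "letter_len Lb k < letter_len La k" by simp
        then show ?thesis using letter_len_order(1)[of k] that(2) by auto
      qed
      then show ?thesis unfolding c_def card that(1) by simp
    qed
    have "j mod 3 = 0 \<or> j mod 3 = 1 \<or> j mod 3 = 2" by linarith
    then show ?thesis
    proof (elim disjE)
      assume j: "j mod 3 = 0"
      have *: "trib (Suc M) = La" "trib M = Lb" "\<not> seed (Suc M)"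
        using trib_num_last(1)[OF j] trib_num_second_last(2)[OF assms j] unfolding last by auto
      have "seed M" by (rule seed_not_La) (simp add: *)
      \<comment> \<open>The final \<open>a\<close> leaves room \<open>letter_len La k\<close> for
        the run of the preceding \<open>b\<close>. For \<open>k < 3\<close> the run fits; otherwise
        \<open>run_len (k - 3)\<close> squares are lost, one less than
        \<open>full_count La k\<close>.\<close>
      have "h M - c M = full_count La k + (if k < 3 then 0 else - 1)"
      proof (cases "k < 3")
        case True
        then have "Suc (run_len k) = letter_len La k"
          using full_count_La[of k] unfolding full_count_def by simp
        then show ?thesis
          using True \<open>seed M\<close> * letter_len_order(2)[of k] letter_len_le_run_len[of Lb k] full_count_La[of k]
          unfolding h_def c_def card by (simp add: full_count_def of_nat_diff min_def)
      next
        case False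
        then have "run_len k = letter_len La k + run_len (k - 3)"
          using run_len_step[of "k - 3"] by simp
        then show ?thesis
          using False \<open>seed M\<close> * letter_len_order(2)[of k] full_count_La[of k]
          unfolding h_def c_def card by (simp add: full_count_def of_nat_diff min_def)
      qed
      then show ?thesis using j * unfolding defect_def h_def by simp
    next
      assume j: "j mod 3 = 1"
      have *: "trib (Suc M) = Lb" "trib M = La" "seed M"
        using trib_num_last(2)[OF j] trib_num_second_last(1)[OF assms] j unfolding last by auto
      moreover have "seed (Suc M)" by (rule seed_not_La) (simp add: *)
      ultimately show ?thesis using j blocked unfolding defect_def h_def by simp
    next
      assume j: "j mod 3 = 2"
      have *: "trib (Suc M) = Lc" "trib M = La" "seed M"
        using trib_num_last(3)[OF j] trib_num_second_last(1)[OF assms] j unfolding last by auto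
      moreover have "seed (Suc M)" by (rule seed_not_La) (simp add: *)
      ultimately show ?thesis using j blocked unfolding defect_def h_def by simp
    qed
  qed
  finally show ?thesis unfolding n_def .
qed

section \<open>Closed forms\<close>

lemma num_squares_as_difference:
  "int (num_squares (trib_num m)) = (\<Sum>k<m. full_sum (m - k) k) - (\<Sum>k<m. defect (m - k) k)"
proof -
  have "int (num_squares (trib_num m)) = (\<Sum>k<m. full_sum (m - k) k - defect (m - k) k)"
    unfolding num_squares_trib_num of_nat_sum
  proof (rule sum.cong[OF refl])
    fix k assume "k \<in> {..<m}"
    then show "(\<Sum>s | s < trib_num (m - k) \<and> seed s. int (card (level_squares (trib_num m) k s)))
        = full_sum (m - k) k - defect (m - k) k"
      using level_sum[of "m - k" k] by simp
  qed
  then show ?thesis by (simp add: sum_subtractf)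
qed

lemma full_sum_rec:
  assumes "1 \<le> j"
  shows "full_sum (j + 3) k = full_sum (j + 2) k + full_sum (j + 1) k + full_sum j k"
proof -
  obtain i where "j = Suc i" using assms by (cases j) auto
  then show ?thesis by (simp add: full_sum_def numeral_eq_Suc algebra_simps)
qed

lemma double_full_count:
  "2 * full_count La k = trib_seq (k + 2) + trib_seq (k + 4) - 1 - 2 * trib_seq (k + 3)"
  "2 * full_count Lb k = trib_seq (k + 4) - trib_seq (k + 2) - 2 * trib_seq (k + 1) - 1"
  "2 * full_count Lc k = trib_seq (k + 4) - trib_seq (k + 2) - 1"
  using run_len_trib_seq[of k] unfolding full_count_def letter_len_trib_seq by simp_all

lemma sum_three: fixes f :: "nat \<Rightarrow> int"
  shows "(\<Sum>k<m + 3. f k) = (\<Sum>k<m. f k) + f m + f (m + 1) + f (m + 2)"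
    and "(\<Sum>k<m + 2. f k) = (\<Sum>k<m. f k) + f m + f (m + 1)"
    and "(\<Sum>k<m + 1. f k) = (\<Sum>k<m. f k) + f m"
  by (simp_all add: numeral_eq_Suc)

lemma full_sum_simps:
  "full_sum 1 k = full_count La k + full_count Lb k"
  "full_sum 2 k = 2 * full_count La k + full_count Lb k + full_count Lc k"
  "full_sum 3 k = 2 * full_count La k + 2 * full_count Lb k + full_count Lc k"
  by (simp_all add: full_sum_def numeral_eq_Suc)

lemma full_count_small:
  "full_count d 0 = 0" "full_count La 1 = 0" "full_count Lb 1 = 0" "full_count Lc 1 = 1"
  "full_count La 2 = 0" "full_count Lb 2 = 1" "full_count Lc 2 = 2"
  "full_count La 3 = 1" "full_count Lb 3 = 2" "full_count Lc 3 = 4"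
  "full_count La 4 = 2" "full_count Lb 4 = 4"
  subgoal by (simp add: full_count_def)
  using double_full_count[of 1] double_full_count[of 2] double_full_count[of 3] double_full_count[of 4]
  by simp_all

text \<open>For \<open>k < m\<close> the terms obey the Tribonacci recurrence; the other summands
  are the boundary terms with \<open>m - k\<close> equal to 1, 2 or 3, after cancellation.\<close>

lemma full_convolution_rec:
  fixes F defines "F \<equiv> \<lambda>m. \<Sum>k<m. full_sum (m - k) k"
  shows "F (m + 3) = F (m + 2) + F (m + 1) + F m - full_count La m
    + full_count La (m + 1) + full_count Lc (m + 1) + full_count La (m + 2) + full_count Lb (m + 2)"
proof -
  have "(\<Sum>k<m. full_sum (m + 3 - k) k) = (\<Sum>k<m. full_sum (m + 2 - k) k)
      + (\<Sum>k<m. full_sum (m + 1 - k) k) + (\<Sum>k<m. full_sum (m - k) k)"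
    unfolding sum.distrib[symmetric]
  proof (rule sum.cong[OF refl])
    fix k assume "k \<in> {..<m}"
    then have "1 \<le> m - k" "m + 3 - k = m - k + 3" "m + 2 - k = m - k + 2" "m + 1 - k = m - k + 1"
      by auto
    then show "full_sum (m + 3 - k) k = full_sum (m + 2 - k) k + full_sum (m + 1 - k) k + full_sum (m - k) k"
      using full_sum_rec[of "m - k" k] by (simp only:)
  qed
  moreover have "m + 3 - m = 3" "m + 3 - (m + 1) = 2" "m + 3 - (m + 2) = 1" "m + 2 - m = 2"
    "m + 2 - (m + 1) = 1" "m + 1 - m = 1"
    by simp_all
  ultimately show ?thesis
    unfolding F_def sum_three by (simp only: full_sum_simps)
qed

text \<open>Up to constants the inhomogeneous part of the recurrence solves the Tribonacci
  recurrence itself, and this resonance produces the factor \<open>m\<close>. The constant 33 solves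
  \<open>c = 3 * c - 66\<close>, where 66 comes from the constants in
  \<open>double_full_count\<close>.\<close>

lemma full_convolution:
  "44 * (\<Sum>k<m. full_sum (m - k) k) =
    int m * (18 * trib_seq (m + 3) - 2 * trib_seq (m + 2) - 10 * trib_seq (m + 1))
    - 59 * trib_seq (m + 3) + 26 * trib_seq (m + 2) + 35 * trib_seq (m + 1) + 33"
proof (induction m rule: induct3)
  case (step m)
  define F where "F m = (\<Sum>k<m. full_sum (m - k) k)" for m
  define x y z where "x = trib_seq (m + 1)" and "y = trib_seq (m + 2)" and "z = trib_seq (m + 3)"
  have index: "m + 1 + 1 = m + 2" "m + 1 + 2 = m + 3" "m + 1 + 3 = m + 4" "m + 1 + 4 = m + 5"
    "m + 2 + 1 = m + 3" "m + 2 + 2 = m + 4" "m + 2 + 3 = m + 5" "m + 2 + 4 = m + 6"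
    "m + 3 + 1 = m + 4" "m + 3 + 2 = m + 5" "m + 3 + 3 = m + 6"
    by simp_all
  note xyz = x_def[symmetric] y_def[symmetric] z_def[symmetric]
  have t: "trib_seq (m + 4) = z + y + x" "trib_seq (m + 5) = (z + y + x) + z + y"
    "trib_seq (m + 6) = ((z + y + x) + z + y) + (z + y + x) + z"
    using trib_seq_rec[of "m + 1"] trib_seq_rec[of "m + 2"] trib_seq_rec[of "m + 3"]
    unfolding index xyz by simp_all
  note w = double_full_count[of m, unfolded index t xyz]
    double_full_count[of "m + 1", unfolded index t xyz]
    double_full_count[of "m + 2", unfolded index t xyz]
  note IH = step[folded F_def, unfolded index t xyz of_nat_add of_nat_1 of_nat_numeral]
  have rec: "F (m + 3) = F (m + 2) + F (m + 1) + F m - full_count La m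
    + full_count La (m + 1) + full_count Lc (m + 1) + full_count La (m + 2) + full_count Lb (m + 2)"
    unfolding F_def by (rule full_convolution_rec)
  have "44 * F (m + 3) = 44 * F (m + 2) + 44 * F (m + 1) + 44 * F m + 22 * (- (2 * full_count La m)
    + 2 * full_count La (m + 1) + 2 * full_count Lc (m + 1) + 2 * full_count La (m + 2)
    + 2 * full_count Lb (m + 2))"
    unfolding rec by simp
  also have "\<dots> = (int m + 3) * (18 * (((z + y + x) + z + y) + (z + y + x) + z)
        - 2 * ((z + y + x) + z + y) - 10 * (z + y + x))
      - 59 * (((z + y + x) + z + y) + (z + y + x) + z) + 26 * ((z + y + x) + z + y)
      + 35 * (z + y + x) + 33"
    unfolding IH w by (simp add: algebra_simps)
  finally show ?case unfolding F_def[symmetric] index t xyz of_nat_add of_nat_numeral .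
next
  case 1
  have "(\<Sum>k<1. full_sum (1 - k) k) = full_sum 1 0" by simp
  also have "\<dots> = 0" by (simp only: full_sum_simps full_count_small)
  finally show ?case by (simp add: numeral_eq_Suc)
next
  case 2
  have "(\<Sum>k<2. full_sum (2 - k) k) = full_sum 2 0 + full_sum 1 1" by (simp add: numeral_eq_Suc)
  also have "\<dots> = 0" by (simp only: full_sum_simps full_count_small)
  finally show ?case by (simp add: numeral_eq_Suc)
qed simp

text \<open>The defect depends on its first argument only modulo 3, so raising \<open>m\<close> by 3
  merely appends three terms.\<close>

lemma defect_convolution_rec:
  "(\<Sum>k<m + 3. defect (m + 3 - k) k) = (\<Sum>k<m. defect (m - k) k) + defect 3 m
    + defect 2 (m + 1) + defect 1 (m + 2)"
proof -
  have "(\<Sum>k<m. defect (m + 3 - k) k) = (\<Sum>k<m. defect (m - k) k)"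
  proof (rule sum.cong[OF refl])
    fix k assume "k \<in> {..<m}"
    then have "m + 3 - k = m - k + 3" by simp
    then show "defect (m + 3 - k) k = defect (m - k) k" by (simp only: defect_def mod_add_self2)
  qed
  moreover have "m + 3 - m = 3" "m + 3 - (m + 1) = 2" "m + 3 - (m + 2) = 1" by simp_all
  ultimately show ?thesis unfolding sum_three by (simp only:)
qed

text \<open>The closed form starts at three: for a prefix index of 0, 1 or 2 its right side would be
  2, whereas the sum is 0.\<close>

lemma defect_convolution:
  "2 * (\<Sum>k<m + 3. defect (m + 3 - k) k) = trib_seq (m + 6) + trib_seq (m + 4) + 1 - 2 * (int m + 3)"
proof (induction m rule: induct3)
  case (step m)
  have index: "m + 3 + 1 = m + 4" "m + 3 + 2 = m + 5" "m + 3 + 3 = m + 6" "m + 3 + 4 = m + 7"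
    "m + 3 + 6 = m + 9" "m + 4 + 1 = m + 5" "m + 4 + 2 = m + 6" "m + 4 + 3 = m + 7"
    "m + 4 + 4 = m + 8" "m + 5 + 1 = m + 6" "m + 5 + 2 = m + 7" "m + 5 + 3 = m + 8"
    "m + 5 + 4 = m + 9" "m + 6 + 1 = m + 7" "m + 6 + 2 = m + 8" "m + 6 + 3 = m + 9"
    by simp_all
  have "defect 3 (m + 3) = - 1" "defect 2 (m + 4) = full_count La (m + 4) + full_count Lc (m + 4)"
    "defect 1 (m + 5) = full_count La (m + 5) + full_count Lb (m + 5)"
    by (simp_all add: defect_def)
  note rec = defect_convolution_rec[of "m + 3", unfolded index this]
  have "2 * (\<Sum>k<m + 6. defect (m + 6 - k) k) = 2 * (\<Sum>k<m + 3. defect (m + 3 - k) k) - 2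
      + 2 * full_count La (m + 4) + 2 * full_count Lc (m + 4)
      + 2 * full_count La (m + 5) + 2 * full_count Lb (m + 5)"
    unfolding rec by simp
  also have "\<dots> = trib_seq (m + 9) + trib_seq (m + 7) + 1 - 2 * (int m + 6)"
    unfolding step(1) double_full_count index
    using trib_seq_rec[of "m + 4", unfolded index] trib_seq_rec[of "m + 5", unfolded index]
      trib_seq_rec[of "m + 6", unfolded index]
    by (simp only: algebra_simps)
  finally show ?case unfolding index by (simp add: algebra_simps)
next
  case 0
  have "(\<Sum>k<3. defect (3 - k) k) = defect 3 0 + defect 2 1 + defect 1 2"
    using defect_convolution_rec[of 0] by (simp add: numeral_2_eq_2)
  also have "\<dots> = 2" by (simp only: defect_def full_count_small) simp
  finally show ?case by simp
next
  case 1
  have "(\<Sum>k<4. defect (4 - k) k) = defect 1 0 + defect 3 1 + defect 2 2 + defect 1 3"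
  proof -
    have "(1::nat) + 3 = 4" "(1::nat) + 1 = 2" "(1::nat) + 2 = 3" by simp_all
    note rec = defect_convolution_rec[of 1, unfolded this]
    have "(\<Sum>k<1. defect (1 - k) k) = defect 1 0" by simp
    then show ?thesis using rec by linarith
  qed
  also have "\<dots> = 5" by (simp only: defect_def full_count_small) simp
  finally show ?case by simp
next
  case 2
  have "(\<Sum>k<5. defect (5 - k) k) = defect 2 0 + defect 1 1 + defect 3 2 + defect 2 3 + defect 1 4"
  proof -
    have "(2::nat) + 3 = 5" "(2::nat) + 1 = 3" "(2::nat) + 2 = 4" by simp_all
    note rec = defect_convolution_rec[of 2, unfolded this]
    have "(\<Sum>k<2. defect (2 - k) k) = defect 2 0 + defect 1 1" by (simp add: numeral_2_eq_2)
    then show ?thesis using rec by linarith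
  qed
  also have "\<dots> = 11" by (simp only: defect_def full_count_small) simp
  finally show ?case by simp
qed

theorem mainTheorem11:
  fixes m :: nat
  assumes "m \<ge> 3"
  shows "real (num_squares (trib_num m)) =
    real m / 22 *
      (9 * real (trib_num m) - real (trib_num (m - 1)) - 5 * real (trib_num (m - 2)))
    + 1 / 44 *
      (- 81 * real (trib_num m) + 26 * real (trib_num (m - 1)) + 13 * real (trib_num (m - 2)))
    + real m + 1 / 4"
proof -
  define x y z where "x = int (trib_num m)" and "y = int (trib_num (m - 1))"
    and "z = int (trib_num (m - 2))"
  have t: "trib_seq (m + 3) = x" "trib_seq (m + 2) = y" "trib_seq (m + 1) = z"
    using assms trib_num_trib_seq[of m] trib_num_trib_seq[of "m - 1"] trib_num_trib_seq[of "m - 2"]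
    unfolding x_def y_def z_def by (simp_all add: Suc_diff_Suc numeral_eq_Suc)
  \<comment> \<open>This is where \<open>m \<ge> 3\<close> enters: \<open>defect_convolution\<close>
    is applied at \<open>m - 3\<close>.\<close>
  have "m - 3 + 3 = m" "m - 3 + 6 = m + 3" "m - 3 + 4 = m + 1" "int (m - 3) + 3 = int m"
    using assms by simp_all
  then have d: "2 * (\<Sum>k<m. defect (m - k) k) = x + z + 1 - 2 * int m"
    using defect_convolution[of "m - 3"] unfolding t[symmetric] by (simp only:)
  have "44 * int (num_squares (trib_num m)) =
      44 * (\<Sum>k<m. full_sum (m - k) k) - 22 * (2 * (\<Sum>k<m. defect (m - k) k))"
    unfolding num_squares_as_difference by simp
  also have "\<dots> = int m * (18 * x - 2 * y - 10 * z) - 81 * x + 26 * y + 13 * z + 44 * int m + 11"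
    unfolding full_convolution d t by simp
  finally have "real_of_int (44 * int (num_squares (trib_num m))) =
      real_of_int (int m * (18 * x - 2 * y - 10 * z) - 81 * x + 26 * y + 13 * z + 44 * int m + 11)"
    by (rule arg_cong)
  then show ?thesis
    unfolding x_def y_def z_def by (simp add: field_simps)
qed

end
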